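(* Let $\Omega=[0,1]$, $\lambda>0$, $p\in[1,2]$, $g\in L^2(\Omega)$, and let $K:\Omega^2\to\{0,1\}$ be measurable and symmetric, and such that $K$ is the graph limit of the associated sequence of simple graphs $(G_n)_{n\in\mathbb{N}^*}$ (as defined in the context). Let $u^\star$ be the unique minimizer of $E_\lambda(\cdot,g,K)$ over $L^2(\Omega)$ and let $u_n^\star$ be the unique minimizer over $u_n\in\mathbb{R}^n$ of $$\frac{1}{2\lambda n}\sum_{i=1}^n|u_{ni}-g_{ni}|^2+\frac{1}{2pn^2}\sum_{(i,j)\in E(G_n)}|u_{nj}-u_{ni}|^p .$$ Then the following hold. (i) $\|I_nu_n^\star-u^\star\|_{L^2(\Omega)}\to0$ as $n\to+\infty$. (ii) Let $p\in[1,2[$. Assume moreover that $g\in L^\infty(\Omega)\cap\mathrm{Lip}(s,L^q(\Omega))$ with $s\in\,]0,1]$ and $q\in[2/(3-p),2]$, that $\rho\in[0,2[$, and that $K(x,y)=J(|x-y|)$ for all $(x,y)\in\Omega^2$, with $J$ a nonnegative bounded measurable mapping on $\Omega$. Then for any $\epsilon>0$ there exists $N(\epsilon)\in\mathbb{N}$ such that for any $n\ge N(\epsilon)$ $$\|I_nu_n^\star-u^\star\|_{L^2(\Omega)}^2\le C\,n^{-\min\left(sq/2,\ (2-p)\left(1-\frac{\rho+\epsilon}{2}\right)\right)},$$ where $C$ is a positive constant independent of $n$.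
   Context: $\Omega=[0,1]$. For $u\in L^2(\Omega)$, $$\mathcal{R}_p(u,K)=\frac{1}{2p}\int_{\Omega^2}K(x,y)|u(y)-u(x)|^p\,dx\,dy$$ if this integral is finite and $+\infty$ otherwise, and $E_\lambda(u,g,K)=\frac{1}{2\lambda}\|u-g\|_{L^2(\Omega)}^2+\mathcal{R}_p(u,K)$. For $n\in\mathbb{N}^*$ let $\Omega_i^{(n)}=[\frac{i-1}{n},\frac{i}{n}[$, $i\in[n]=\{1,\dots,n\}$, $\Omega_{ij}^{(n)}=\Omega_i^{(n)}\times\Omega_j^{(n)}$, $g_{ni}=n\int_{\Omega_i^{(n)}}g(x)\,dx$, and $I_nv_n(x)=\sum_{i=1}^nv_{ni}\mathbf{1}_{\Omega_i^{(n)}}(x)$ for $v_n\in\mathbb{R}^n$. Graphs: let $\mathrm{supp}(K)=\{(x,y)\in\Omega^2:K(x,y)\neq0\}$ and let $\overline{\mathrm{supp}(K)}$ be its closure. $G_n$ has vertex set $[n]$ and edge set $E(G_n)=\{(i,j)\in[n]^2:\ \Omega_{ij}^{(n)}\cap\overline{\mathrm{supp}(K)}\neq\emptyset\}$. Let $K_{G_n}:\Omega^2\to\{0,1\}$ equal $1$ on $\Omega_{ij}^{(n)}$ if $(i,j)\in E(G_n)$, and $0$ otherwise. "$K$ is the graph limit of $(G_n)$" means that for every finite simple graph $F$, $t(F,K_{G_n})\to t(F,K)$ as $n\to\infty$, where $t(F,W)=\int_{\Omega^{|V(F)|}}\prod_{(i,j)\in E(F)}W(x_i,x_j)\,dx$.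 Dimension: $\rho$ is the upper box-counting dimension of the boundary $\partial\overline{\mathrm{supp}(K)}$, regarded as a subset of $\mathbb{R}^2$: $\rho=\limsup_{\delta\to0}\frac{\log N_\delta}{-\log\delta}$, where $N_\delta$ is the number of cells of a $(\delta\times\delta)$-mesh intersecting $\partial\overline{\mathrm{supp}(K)}$. Lipschitz spaces: for $F\in L^q(\Omega)$ let $\omega(F,h)_q=\sup_{|z|<h}\big(\int_{\{x:\,x,x+z\in\Omega\}}|F(x+z)-F(x)|^q\,dx\big)^{1/q}$; $\mathrm{Lip}(s,L^q(\Omega))$ is the set of $F\in L^q(\Omega)$ with $\sup_{h>0}h^{-s}\omega(F,h)_q<+\infty$. *)

theory Defs
  imports "HOL-Analysis.Analysis"
begin

abbreviation Omega :: "real set"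
  where "Omega \<equiv> {0..1}"

section \<open>Lebesgue and Lipschitz spaces on the unit interval\<close>

text \<open>
  Elements of these spaces are functions on the whole real line of which only the restriction
  to \<open>Omega\<close> matters; they are not quotiented by equality almost everywhere.
\<close>

definition L_space :: "real \<Rightarrow> (real \<Rightarrow> real) set"
  where "L_space q = {f. f \<in> borel_measurable (lebesgue_on Omega) \<and>
                         integrable (lebesgue_on Omega) (\<lambda>x. \<bar>f x\<bar> powr q)}"

definition L_norm :: "real \<Rightarrow> (real \<Rightarrow> real) \<Rightarrow> real"
  where "L_norm q f = (integral\<^sup>L (lebesgue_on Omega) (\<lambda>x. \<bar>f x\<bar> powr q)) powr (1 / q)"

definition L_infinity :: "(real \<Rightarrow> real) set"
  where "L_infinity = {f. f \<in> borel_measurable (lebesgue_on Omega) \<and>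
                          (\<exists>M. AE x in lebesgue_on Omega. \<bar>f x\<bar> \<le> M)}"

text \<open>
  For \<open>F \<in> L_space q\<close> with \<open>q \<ge> 1\<close> and for \<open>h > 0\<close>, the supremum below is over a nonempty set
  bounded by twice the norm of \<open>F\<close>, so the real-valued supremum is the intended one.
\<close>

definition modulus :: "real \<Rightarrow> (real \<Rightarrow> real) \<Rightarrow> real \<Rightarrow> real"
  where "modulus q F h =
    (SUP z\<in>{z. \<bar>z\<bar> < h}.
      (integral\<^sup>L (lebesgue_on {x. x \<in> Omega \<and> x + z \<in> Omega})
         (\<lambda>x. \<bar>F (x + z) - F x\<bar> powr q)) powr (1 / q))"

definition Lip_space :: "real \<Rightarrow> real \<Rightarrow> (real \<Rightarrow> real) set"
  where "Lip_space s q =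
    {F \<in> L_space q. bdd_above ((\<lambda>h. h powr (- s) * modulus q F h) ` {0<..})}"

section \<open>The nonlocal energy\<close>

definition nonlocal_reg :: "real \<Rightarrow> (real \<times> real \<Rightarrow> real) \<Rightarrow> (real \<Rightarrow> real) \<Rightarrow> ereal"
  where "nonlocal_reg p K u =
    (let f = (\<lambda>(x, y). K (x, y) * \<bar>u y - u x\<bar> powr p);
         M = lebesgue_on (Omega \<times> Omega) :: (real \<times> real) measure
     in if integrable M f then ereal (1 / (2 * p) * integral\<^sup>L M f) else \<infinity>)"

definition energy ::
  "real \<Rightarrow> real \<Rightarrow> (real \<Rightarrow> real) \<Rightarrow> (real \<times> real \<Rightarrow> real) \<Rightarrow> (real \<Rightarrow> real) \<Rightarrow> ereal"
  where "energy lam p g K u =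
    ereal (1 / (2 * lam) * (L_norm 2 (\<lambda>x. u x - g x))\<^sup>2) + nonlocal_reg p K u"

section \<open>Discretisation\<close>

text \<open>A vector in \<open>n\<close>-dimensional space is a function \<open>nat \<Rightarrow> real\<close> used only at \<open>1, \<dots>, n\<close>.\<close>

definition cell :: "nat \<Rightarrow> nat \<Rightarrow> real set"
  where "cell n i = {(real i - 1) / real n ..< real i / real n}"

definition cell_avg :: "(real \<Rightarrow> real) \<Rightarrow> nat \<Rightarrow> nat \<Rightarrow> real"
  where "cell_avg g n i = real n * integral\<^sup>L (lebesgue_on (cell n i)) g"

definition step_fun :: "nat \<Rightarrow> (nat \<Rightarrow> real) \<Rightarrow> real \<Rightarrow> real"
  where "step_fun n v x = (\<Sum>i=1..n. v i * indicator (cell n i) x)"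

definition kernel_supp :: "(real \<times> real \<Rightarrow> real) \<Rightarrow> (real \<times> real) set"
  where "kernel_supp K = {z \<in> Omega \<times> Omega. K z \<noteq> 0}"

definition graph_edges :: "(real \<times> real \<Rightarrow> real) \<Rightarrow> nat \<Rightarrow> (nat \<times> nat) set"
  where "graph_edges K n =
    {(i, j) \<in> {1..n} \<times> {1..n}. (cell n i \<times> cell n j) \<inter> closure (kernel_supp K) \<noteq> {}}"

definition discrete_energy ::
  "real \<Rightarrow> real \<Rightarrow> (real \<Rightarrow> real) \<Rightarrow> (real \<times> real \<Rightarrow> real) \<Rightarrow> nat \<Rightarrow> (nat \<Rightarrow> real) \<Rightarrow> real"
  where "discrete_energy lam p g K n v =
    1 / (2 * lam * real n) * (\<Sum>i=1..n. \<bar>v i - cell_avg g n i\<bar>\<^sup>2) +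
    1 / (2 * p * (real n)\<^sup>2) * (\<Sum>(i, j)\<in>graph_edges K n. \<bar>v j - v i\<bar> powr p)"

section \<open>Graph limits\<close>

definition graph_kernel :: "nat \<Rightarrow> (nat \<times> nat) set \<Rightarrow> real \<times> real \<Rightarrow> real"
  where "graph_kernel n E z = (if \<exists>(i, j)\<in>E. z \<in> cell n i \<times> cell n j then 1 else 0)"

definition finite_simple_graph :: "nat set \<Rightarrow> (nat \<times> nat) set \<Rightarrow> bool"
  where "finite_simple_graph V E \<longleftrightarrow> finite V \<and> E \<subseteq> V \<times> V \<and> sym E \<and> irrefl E"

text \<open>
  An undirected edge is a symmetric pair of elements of \<open>E\<close>; the condition \<open>i < j\<close> makes it
  contribute one factor (all kernels here are symmetric).  The measure is Lebesgue measure on the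
  cube indexed by \<open>V\<close>; the completion is needed because a Lebesgue measurable \<open>W\<close> need not make
  the integrand measurable for the product sigma-algebra.
\<close>

definition hom_density ::
  "nat set \<Rightarrow> (nat \<times> nat) set \<Rightarrow> (real \<times> real \<Rightarrow> real) \<Rightarrow> real"
  where "hom_density V E W =
    integral\<^sup>L (completion (PiM V (\<lambda>_. restrict_space lborel Omega)))
      (\<lambda>x. \<Prod>(i, j)\<in>{(i, j) \<in> E. i < j}. W (x i, x j))"

definition is_graph_limit ::
  "(real \<times> real \<Rightarrow> real) \<Rightarrow> (nat \<Rightarrow> (nat \<times> nat) set) \<Rightarrow> bool"
  where "is_graph_limit K G \<longleftrightarrow>
    (\<forall>V E. finite_simple_graph V E \<longrightarrow>
       (\<lambda>n. hom_density V E (graph_kernel n (G n))) \<longlonglongrightarrow> hom_density V E K)"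

section \<open>Box-counting dimension\<close>

definition mesh_cell :: "real \<Rightarrow> int \<times> int \<Rightarrow> (real \<times> real) set"
  where "mesh_cell \<delta> = (\<lambda>(a, b). {of_int a * \<delta> .. (of_int a + 1) * \<delta>} \<times>
                                  {of_int b * \<delta> .. (of_int b + 1) * \<delta>})"

definition mesh_count :: "real \<Rightarrow> (real \<times> real) set \<Rightarrow> nat"
  where "mesh_count \<delta> S = card {c. mesh_cell \<delta> c \<inter> S \<noteq> {}}"

text \<open>
  Meant for bounded \<open>S\<close>, for which the counts are finite.  Since \<open>ln 0 = 0\<close>, the empty set
  has dimension 0.
\<close>

definition upper_box_dim :: "(real \<times> real) set \<Rightarrow> ereal"
  where "upper_box_dim S =
    Limsup (at_right 0) (\<lambda>\<delta>. ereal (ln (real (mesh_count \<delta> S)) / (- ln \<delta>)))"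

end

theory Submission
  imports Defs "HOL-Probability.Probability"
begin

text \<open>
  Let \<open>T\<close> be the closed support of \<open>K\<close>, \<open>K\<^sub>n\<close> the kernel of \<open>G\<^sub>n\<close>, \<open>P\<^sub>n\<close> the projection onto cell
  averages and \<open>w\<^sub>n\<close> the step function of the discrete minimizer.  Since \<open>K \<le> 1\<^sub>T \<le> K\<^sub>n\<close>, convergence of
  the densities of a single edge already gives \<open>K = 1\<^sub>T\<close> a.e. and \<open>K\<^sub>n \<rightarrow> K\<close> in \<open>L\<^sup>1\<close>.  The energy for
  \<open>K\<close> at \<open>w\<^sub>n\<close> is at most the one for \<open>K\<^sub>n\<close>, and on the cells Jensen's inequality shows that passing to
  \<open>P\<^sub>n u\<^sup>\<star>\<close> does not increase the regularizer for \<open>K\<^sub>n\<close>.  With the strong convexity of the energy at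
  \<open>u\<^sup>\<star>\<close> this yields
  \<open>\<parallel>w\<^sub>n - u\<^sup>\<star>\<parallel>\<^sup>2 \<le> \<parallel>g - P\<^sub>n g\<parallel>\<^sup>2 + (\<lambda>/p) \<integral>\<integral> (K\<^sub>n - K) |u\<^sup>\<star>(y) - u\<^sup>\<star>(x)|\<^sup>p\<close>.
  Both terms tend to \<open>0\<close>.  If \<open>g\<close> is bounded then so is \<open>u\<^sup>\<star>\<close>, by truncation; the last integral is then
  controlled by the number of cells meeting the boundary of \<open>T\<close>, and the first term by the modulus of
  smoothness of \<open>g\<close>.
\<close>

section \<open>Convexity of the nonlocal energy\<close>

text \<open>The comparison is one-sided on purpose: since \<open>K\<^sub>n - K\<close> is
  nonnegative, passing from \<open>K\<^sub>n\<close> to \<open>K\<close> at \<open>w\<^sub>n\<close>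
  only lowers the energy, and the defect \<open>K\<^sub>n - K\<close> is integrated against the
  fixed function u_star alone, so no uniform control of the discrete minimizers is called for. The
  exponents obtained are s * q for the data and 2 - (\<rho> + \<epsilon>) for the kernel. If \<rho>
  + \<epsilon> \<le> 2 they dominate the claimed ones; for larger \<epsilon> the claimed power of n
  does not decay and convergence alone is enough. The obstacle is measure-theoretic. The statement
  speaks of Lebesgue measurable functions, but the product of completed sigma-algebras is not the
  completed one on the square, while Fubini arguments need a product measure. Every function is
  therefore exchanged for a Borel representative and integrated against a Borel version of
  restricted Lebesgue measure.\<close>

lemma convex_on_abs_powr:
  fixes p :: real
  assumes "p \<ge> 1"
  shows "convex_on UNIV (\<lambda>x::real. \<bar>x\<bar> powr p)"
proof (rule convex_onI)
  \<comment> \<open>A zero argument is a case of its own: there the claim is (s * c) powr p \<le> s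
    * c powr p, that is, s powr p \<le> s for 0 < s < 1.\<close>
  have pos: "((1 - t) * a + t * b) powr p \<le> (1 - t) * a powr p + t * b powr p"
    if t: "0 < t" "t < 1" and ab: "0 \<le> a" "0 \<le> b" for t a b :: real
  proof -
    have scale: "(s * c) powr p \<le> s * c powr p" if "0 < s" "s < 1" "0 \<le> c" for s c :: real
    proof -
      have "s powr p \<le> s powr 1"
        using that assms by (intro powr_mono') auto
      then show ?thesis
        using that by (simp add: powr_mult mult_right_mono)
    qed
    consider "a = 0" | "b = 0" | "a > 0" "b > 0"
      using ab by linarith
    then show ?thesis
    proof cases
      case 1
      then show ?thesis using scale[of t b] t ab by simp
    next
      case 2
      then show ?thesis using scale[of "1 - t" a] t ab by simp
    next
      case 3
      then show ?thesis
        using convex_onD[OF powr_convex[OF assms], of t a b] t by simp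
    qed
  qed
  fix t x y :: real
  assume t: "0 < t" "t < 1"
  have "\<bar>(1 - t) *\<^sub>R x + t *\<^sub>R y\<bar> \<le> (1 - t) * \<bar>x\<bar> + t * \<bar>y\<bar>"
    using abs_triangle_ineq[of "(1 - t) * x" "t * y"] t by (simp add: abs_mult)
  then have "\<bar>(1 - t) *\<^sub>R x + t *\<^sub>R y\<bar> powr p \<le> ((1 - t) * \<bar>x\<bar> + t * \<bar>y\<bar>) powr p"
    using assms by (intro powr_mono2) auto
  also have "\<dots> \<le> (1 - t) * \<bar>x\<bar> powr p + t * \<bar>y\<bar> powr p"
    using t by (intro pos) auto
  finally show "\<bar>(1 - t) *\<^sub>R x + t *\<^sub>R y\<bar> powr p \<le> (1 - t) * \<bar>x\<bar> powr p + t * \<bar>y\<bar> powr p" .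
qed auto

text \<open>The power is at most 1 or at most the square, according to the size of |a - b|. The
  right-hand side is integrable over a finite measure for square-integrable data, which keeps every
  regularizer with a bounded kernel finite.\<close>

lemma abs_diff_powr_le:
  fixes p a b :: real
  assumes "1 \<le> p" "p \<le> 2"
  shows "\<bar>a - b\<bar> powr p \<le> 1 + 2 * a\<^sup>2 + 2 * b\<^sup>2"
proof -
  have sq: "(a - b)\<^sup>2 \<le> 2 * a\<^sup>2 + 2 * b\<^sup>2"
    using sum_squares_bound[of a "-b"] by (simp add: power2_diff)
  show ?thesis
  proof (cases "\<bar>a - b\<bar> \<le> 1")
    case True
    then have "\<bar>a - b\<bar> powr p \<le> 1"
      using assms by (intro powr_le1) auto
    then show ?thesis
      by (smt (verit) zero_le_power2)
  next
    case False
    then have "\<bar>a - b\<bar> powr p \<le> \<bar>a - b\<bar> powr 2"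
      using assms by (intro powr_mono) auto
    also have "\<dots> = (a - b)\<^sup>2"
      using False by (simp add: powr_numeral)
    finally show ?thesis using sq by linarith
  qed
qed

section \<open>Square-integrable functions over an arbitrary measure\<close>

definition sq_integrable :: "'a measure \<Rightarrow> ('a \<Rightarrow> real) set"
  where "sq_integrable M = {f \<in> borel_measurable M. integrable M (\<lambda>x. (f x)\<^sup>2)}"

lemma sq_integrableD [dest, measurable_dest]:
  "f \<in> sq_integrable M \<Longrightarrow> f \<in> borel_measurable M"
  by (simp add: sq_integrable_def)

lemma sq_integrable_mult:
  assumes "f \<in> sq_integrable M" "h \<in> sq_integrable M"
  shows "integrable M (\<lambda>x. f x * h x)"
proof (rule Bochner_Integration.integrable_bound)
  show "integrable M (\<lambda>x. (f x)\<^sup>2 + (h x)\<^sup>2)"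
    using assms by (auto simp: sq_integrable_def)
  show "(\<lambda>x. f x * h x) \<in> borel_measurable M"
    using assms by (auto simp: sq_integrable_def)
  have "\<bar>a * b\<bar> \<le> a\<^sup>2 + b\<^sup>2" for a b :: real
  proof -
    have "2 * (\<bar>a\<bar> * \<bar>b\<bar>) \<le> a\<^sup>2 + b\<^sup>2"
      using sum_squares_bound[of "\<bar>a\<bar>" "\<bar>b\<bar>"] by simp
    moreover have "0 \<le> \<bar>a\<bar> * \<bar>b\<bar>" by simp
    ultimately show ?thesis unfolding abs_mult by linarith
  qed
  then show "AE x in M. norm (f x * h x) \<le> norm ((f x)\<^sup>2 + (h x)\<^sup>2)"
    by simp
qed

lemma sq_integrable_scale:
  assumes "f \<in> sq_integrable M"
  shows "(\<lambda>x. c * f x) \<in> sq_integrable M"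
  using assms by (auto simp: sq_integrable_def power_mult_distrib)

lemma sq_integrable_add:
  assumes "f \<in> sq_integrable M" "h \<in> sq_integrable M"
  shows "(\<lambda>x. f x + h x) \<in> sq_integrable M"
  using assms sq_integrable_mult[OF assms]
  by (auto simp: sq_integrable_def power2_sum mult.assoc)

lemma sq_integrable_diff:
  assumes "f \<in> sq_integrable M" "h \<in> sq_integrable M"
  shows "(\<lambda>x. f x - h x) \<in> sq_integrable M"
  using assms sq_integrable_mult[OF assms]
  by (auto simp: sq_integrable_def power2_diff mult.assoc)

lemma sq_integrable_square:
  "f \<in> sq_integrable M \<Longrightarrow> integrable M (\<lambda>x. (f x)\<^sup>2)"
  by (simp add: sq_integrable_def)

lemma (in finite_measure) sq_integrable_bounded:
  assumes "f \<in> borel_measurable M" "\<And>x. \<bar>f x\<bar> \<le> B"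
  shows "f \<in> sq_integrable M"
proof -
  have "(f x)\<^sup>2 \<le> B\<^sup>2" for x
    using assms(2) by (rule abs_le_square_iff[THEN iffD1, OF order_trans]) simp
  then have "integrable M (\<lambda>x. (f x)\<^sup>2)"
    using assms(1) by (intro integrable_const_bound[where B="B\<^sup>2"]) auto
  then show ?thesis
    using assms by (simp add: sq_integrable_def)
qed

lemma (in finite_measure) sq_integrable_integrable:
  assumes "f \<in> sq_integrable M"
  shows "integrable M f"
  using sq_integrable_mult[OF assms sq_integrable_bounded[of "\<lambda>_. 1" 1]] by simp

text \<open>The regularizer without its factor 1 / (2 * p), real-valued instead of extended. The
  default value 0 of a divergent integral does no harm: \<open>integrable_dirichlet\<close> excludes
  divergence for square-integrable functions.\<close>

definition dirichlet :: "'a measure \<Rightarrow> real \<Rightarrow> ('a \<times> 'a \<Rightarrow> real) \<Rightarrow> ('a \<Rightarrow> real) \<Rightarrow> real"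
  where "dirichlet M p k v = (\<integral>z. k z * \<bar>v (snd z) - v (fst z)\<bar> powr p \<partial>(M \<Otimes>\<^sub>M M))"

definition kernel_energy ::
  "'a measure \<Rightarrow> real \<Rightarrow> real \<Rightarrow> ('a \<Rightarrow> real) \<Rightarrow> ('a \<times> 'a \<Rightarrow> real) \<Rightarrow> ('a \<Rightarrow> real) \<Rightarrow> real"
  where "kernel_energy M lam p g k v =
    1 / (2 * lam) * (\<integral>x. (v x - g x)\<^sup>2 \<partial>M) + 1 / (2 * p) * dirichlet M p k v"

text \<open>Used for the limit kernel, for the kernels of the graphs, and for the constant kernel 1,
  where only the integrability facts are drawn from it.\<close>

locale kernel_problem = prob_space M for M :: "'a measure" +
  fixes lam p :: real and g :: "'a \<Rightarrow> real" and k :: "'a \<times> 'a \<Rightarrow> real"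
  assumes lam: "lam > 0" and p: "1 \<le> p" "p \<le> 2"
    and g: "g \<in> sq_integrable M"
    and k_meas [measurable]: "k \<in> borel_measurable (M \<Otimes>\<^sub>M M)"
    and k_range: "\<And>z. 0 \<le> k z" "\<And>z. k z \<le> 1"
begin

lemma integrable_pair_fst:
  fixes f :: "'a \<Rightarrow> real"
  assumes "integrable M f"
  shows "integrable (M \<Otimes>\<^sub>M M) (\<lambda>z. f (fst z))" "integrable (M \<Otimes>\<^sub>M M) (\<lambda>z. f (snd z))"
proof -
  interpret pair: pair_prob_space M M ..
  have "distr (M \<Otimes>\<^sub>M M) M fst = M"
    by (rule distr_pair_fst)
  then show 1: "integrable (M \<Otimes>\<^sub>M M) (\<lambda>z. f (fst z))"
    using integrable_distr[of fst "M \<Otimes>\<^sub>M M" M f] assms by simp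
  show "integrable (M \<Otimes>\<^sub>M M) (\<lambda>z. f (snd z))"
    using pair.integrable_product_swap[OF 1] by (simp add: case_prod_beta')
qed

lemma integrable_powr_diff:
  assumes v: "v \<in> sq_integrable M"
  shows "integrable (M \<Otimes>\<^sub>M M) (\<lambda>z. \<bar>v (snd z) - v (fst z)\<bar> powr p)"
proof (rule Bochner_Integration.integrable_bound)
  interpret pair: pair_prob_space M M ..
  have [measurable]: "v \<in> borel_measurable M" using v by auto
  show "integrable (M \<Otimes>\<^sub>M M) (\<lambda>z. 1 + 2 * (v (snd z))\<^sup>2 + 2 * (v (fst z))\<^sup>2)"
    using integrable_pair_fst[OF sq_integrable_square[OF v]]
    by (intro Bochner_Integration.integrable_add pair.integrable_const integrable_mult_right)
  show "(\<lambda>z. \<bar>v (snd z) - v (fst z)\<bar> powr p) \<in> borel_measurable (M \<Otimes>\<^sub>M M)"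
    by measurable
  show "AE z in M \<Otimes>\<^sub>M M. norm (\<bar>v (snd z) - v (fst z)\<bar> powr p)
      \<le> norm (1 + 2 * (v (snd z))\<^sup>2 + 2 * (v (fst z))\<^sup>2)"
  proof (intro AE_I2)
    fix z
    show "norm (\<bar>v (snd z) - v (fst z)\<bar> powr p) \<le> norm (1 + 2 * (v (snd z))\<^sup>2 + 2 * (v (fst z))\<^sup>2)"
      using abs_diff_powr_le[OF p, of "v (snd z)" "v (fst z)"] by simp
  qed
qed

lemma integrable_dirichlet:
  assumes v: "v \<in> sq_integrable M"
  shows "integrable (M \<Otimes>\<^sub>M M) (\<lambda>z. k z * \<bar>v (snd z) - v (fst z)\<bar> powr p)"
proof (rule Bochner_Integration.integrable_bound[OF integrable_powr_diff[OF v]])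
  have [measurable]: "v \<in> borel_measurable M" using v by auto
  show "(\<lambda>z. k z * \<bar>v (snd z) - v (fst z)\<bar> powr p) \<in> borel_measurable (M \<Otimes>\<^sub>M M)"
    by measurable
qed (auto simp: abs_mult k_range intro!: mult_left_le_one_le)

text \<open>The quadratic gain comes entirely from the fidelity term, for which convexity is the
  exact identity ((1-t) a + t b)^2 = (1-t) a^2 + t b^2 - t (1-t) (b - a)^2. The regularizer
  contributes plain convexity.\<close>

lemma kernel_energy_convex:
  assumes v: "v \<in> sq_integrable M" and w: "w \<in> sq_integrable M" and t: "0 < t" "t < 1"
  shows "kernel_energy M lam p g k (\<lambda>x. (1 - t) * v x + t * w x)
    \<le> (1 - t) * kernel_energy M lam p g k v + t * kernel_energy M lam p g k w
      - t * (1 - t) * (1 / (2 * lam) * (\<integral>x. (w x - v x)\<^sup>2 \<partial>M))"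
proof -
  let ?m = "\<lambda>x. (1 - t) * v x + t * w x"
  have m: "?m \<in> sq_integrable M"
    by (intro sq_integrable_add sq_integrable_scale v w)
  have I: "integrable M (\<lambda>x. (v x - g x)\<^sup>2)" "integrable M (\<lambda>x. (w x - g x)\<^sup>2)"
    "integrable M (\<lambda>x. (w x - v x)\<^sup>2)"
    by (intro sq_integrable_square sq_integrable_diff v w g)+
  have "(\<integral>x. (?m x - g x)\<^sup>2 \<partial>M)
      = (\<integral>x. (1 - t) * (v x - g x)\<^sup>2 + t * (w x - g x)\<^sup>2 - t * (1 - t) * (w x - v x)\<^sup>2 \<partial>M)"
    by (rule Bochner_Integration.integral_cong) (auto simp: power2_eq_square algebra_simps)
  also have "\<dots> = (1 - t) * (\<integral>x. (v x - g x)\<^sup>2 \<partial>M) + t * (\<integral>x. (w x - g x)\<^sup>2 \<partial>M)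
      - t * (1 - t) * (\<integral>x. (w x - v x)\<^sup>2 \<partial>M)"
    using I by simp
  finally have fid: "(\<integral>x. (?m x - g x)\<^sup>2 \<partial>M) = \<dots>" .
  have "dirichlet M p k ?m \<le> (\<integral>z. (1 - t) * (k z * \<bar>v (snd z) - v (fst z)\<bar> powr p)
      + t * (k z * \<bar>w (snd z) - w (fst z)\<bar> powr p) \<partial>(M \<Otimes>\<^sub>M M))"
    unfolding dirichlet_def
  proof (rule integral_mono)
    show "integrable (M \<Otimes>\<^sub>M M) (\<lambda>z. k z * \<bar>?m (snd z) - ?m (fst z)\<bar> powr p)"
      by (rule integrable_dirichlet[OF m])
    show "integrable (M \<Otimes>\<^sub>M M) (\<lambda>z. (1 - t) * (k z * \<bar>v (snd z) - v (fst z)\<bar> powr p)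
      + t * (k z * \<bar>w (snd z) - w (fst z)\<bar> powr p))"
      using integrable_dirichlet[OF v] integrable_dirichlet[OF w] by auto
    fix z :: "'a \<times> 'a"
    let ?a = "v (snd z) - v (fst z)" and ?b = "w (snd z) - w (fst z)"
    have "\<bar>?m (snd z) - ?m (fst z)\<bar> powr p = \<bar>(1 - t) *\<^sub>R ?a + t *\<^sub>R ?b\<bar> powr p"
      by (simp add: algebra_simps)
    also have "\<dots> \<le> (1 - t) * \<bar>?a\<bar> powr p + t * \<bar>?b\<bar> powr p"
      using t by (intro convex_onD[OF convex_on_abs_powr[OF p(1)]]) auto
    finally have "k z * \<bar>?m (snd z) - ?m (fst z)\<bar> powr p
        \<le> k z * ((1 - t) * \<bar>?a\<bar> powr p + t * \<bar>?b\<bar> powr p)"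
      by (rule mult_left_mono[OF _ k_range(1)])
    then show "k z * \<bar>?m (snd z) - ?m (fst z)\<bar> powr p
        \<le> (1 - t) * (k z * \<bar>?a\<bar> powr p) + t * (k z * \<bar>?b\<bar> powr p)"
      by (simp add: algebra_simps)
  qed
  also have "\<dots> = (1 - t) * dirichlet M p k v + t * dirichlet M p k w"
    using integrable_dirichlet[OF v] integrable_dirichlet[OF w] by (simp add: dirichlet_def)
  finally have "1 / (2 * p) * dirichlet M p k ?m
      \<le> 1 / (2 * p) * ((1 - t) * dirichlet M p k v + t * dirichlet M p k w)"
    using p by (intro mult_left_mono) auto
  moreover have "a * ((1 - t) * x + t * y - t * (1 - t) * z) + b * d
      \<le> (1 - t) * (a * x + b * x') + t * (a * y + b * y') - t * (1 - t) * (a * z)"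
    if "b * d \<le> b * ((1 - t) * x' + t * y')" for a b d x y z x' y' :: real
    using that by (simp add: algebra_simps)
  ultimately show ?thesis
    unfolding kernel_energy_def fid by blast
qed

text \<open>The minimizer is compared with points of the segment from \<open>us\<close> to
  \<open>w\<close>. Dividing by t leaves the factor 1 - t on the left, and t \<rightarrow> 0 removes
  it; a fixed t such as 1/2 would lose a constant.\<close>

lemma minimizer_strong_convexity:
  assumes us: "us \<in> sq_integrable M" and w: "w \<in> sq_integrable M"
    and min: "\<And>v. v \<in> sq_integrable M \<Longrightarrow> kernel_energy M lam p g k us \<le> kernel_energy M lam p g k v"
  shows "1 / (2 * lam) * (\<integral>x. (w x - us x)\<^sup>2 \<partial>M)
    \<le> kernel_energy M lam p g k w - kernel_energy M lam p g k us"
proof -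
  let ?D = "1 / (2 * lam) * (\<integral>x. (w x - us x)\<^sup>2 \<partial>M)"
    and ?d = "kernel_energy M lam p g k w - kernel_energy M lam p g k us"
  have le: "(1 - t) * ?D \<le> ?d" if t: "0 < t" "t < 1" for t
  proof -
    have "kernel_energy M lam p g k us \<le> kernel_energy M lam p g k (\<lambda>x. (1 - t) * us x + t * w x)"
      by (intro min sq_integrable_add sq_integrable_scale us w)
    also note kernel_energy_convex[OF us w t]
    finally have "t * ((1 - t) * ?D) \<le> t * ?d"
      by (simp add: algebra_simps)
    then show ?thesis
      using t(1) by (simp only: mult_le_cancel_left_pos)
  qed
  have "((\<lambda>t. (1 - t) * ?D) \<longlongrightarrow> (1 - 0) * ?D) (at_right 0)"
    by (intro tendsto_intros)
  moreover have "\<forall>\<^sub>F t in at_right 0. (1 - t) * ?D \<le> ?d"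
    unfolding eventually_at_right[of 0 "1::real", OF zero_less_one] using le by (intro exI[of _ 1]) auto
  ultimately show ?thesis
    using tendsto_upperbound[of "\<lambda>t. (1 - t) * ?D" "(1 - 0) * ?D" "at_right (0::real)" ?d]
    by (simp only: trivial_limit_at_right_real diff_zero mult_1 not_False_eq_True)
qed

text \<open>Clipping to [-B, B] is 1-Lipschitz and fixes almost all values of \<open>g\<close>, so
  it increases neither term of the energy. By strong convexity the clipped function is then at
  distance 0 from \<open>us\<close>.\<close>

lemma minimizer_bounded:
  assumes us: "us \<in> sq_integrable M"
    and min: "\<And>v. v \<in> sq_integrable M \<Longrightarrow> kernel_energy M lam p g k us \<le> kernel_energy M lam p g k v"
    and bd: "AE x in M. \<bar>g x\<bar> \<le> B"
  shows "AE x in M. \<bar>us x\<bar> \<le> B"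
proof -
  have [measurable]: "us \<in> borel_measurable M" "g \<in> borel_measurable M"
    using us g by auto
  \<comment> \<open>An a.e. statement on a probability space is never vacuous, so the bound on |g|
    forces B to be nonnegative.\<close>
  have "AE x in M. 0 \<le> B" using bd by eventually_elim linarith
  then have B: "0 \<le> B" by auto
  define c where "c = (\<lambda>a::real. max (- B) (min a B))"
  have c1: "\<bar>c a - c b\<bar> \<le> \<bar>a - b\<bar>" for a b
    by (auto simp: c_def max_def min_def)
  have c2: "c a = a" if "\<bar>a\<bar> \<le> B" for a
    using that by (auto simp: c_def max_def min_def)
  have cB: "\<bar>c a\<bar> \<le> B" for a
    using B by (auto simp: c_def max_def min_def)
  let ?w = "\<lambda>x. c (us x)"
  have [measurable]: "?w \<in> borel_measurable M"
    unfolding c_def by measurable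
  have w: "?w \<in> sq_integrable M"
    by (rule sq_integrable_bounded[of ?w B]) (auto simp: cB)
  have "(\<integral>x. (?w x - g x)\<^sup>2 \<partial>M) \<le> (\<integral>x. (us x - g x)\<^sup>2 \<partial>M)"
  proof (rule integral_mono_AE)
    show "AE x in M. (?w x - g x)\<^sup>2 \<le> (us x - g x)\<^sup>2"
      using bd
    proof eventually_elim
      case (elim x)
      then show ?case
        using c1[of "us x" "g x"] c2[of "g x"] by (simp add: abs_le_square_iff)
    qed
  qed (intro sq_integrable_square sq_integrable_diff us w g)+
  moreover have "dirichlet M p k ?w \<le> dirichlet M p k us"
    unfolding dirichlet_def
  proof (rule integral_mono)
    fix z
    show "k z * \<bar>?w (snd z) - ?w (fst z)\<bar> powr p \<le> k z * \<bar>us (snd z) - us (fst z)\<bar> powr p"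
      using p by (intro mult_left_mono powr_mono2 c1 k_range) auto
  qed (intro integrable_dirichlet us w)+
  ultimately have "kernel_energy M lam p g k ?w \<le> kernel_energy M lam p g k us"
    unfolding kernel_energy_def using lam p by (intro add_mono mult_left_mono) auto
  then have "1 / (2 * lam) * (\<integral>x. (?w x - us x)\<^sup>2 \<partial>M) \<le> 0"
    using minimizer_strong_convexity[OF us w min] by linarith
  then have "(\<integral>x. (?w x - us x)\<^sup>2 \<partial>M) \<le> 0"
    using lam by (simp add: mult_le_0_iff divide_le_0_iff)
  moreover have "0 \<le> (\<integral>x. (?w x - us x)\<^sup>2 \<partial>M)"
    by simp
  ultimately have "(\<integral>x. (?w x - us x)\<^sup>2 \<partial>M) = 0"
    by linarith
  then have "AE x in M. (?w x - us x)\<^sup>2 = 0"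
    by (subst (asm) integral_nonneg_eq_0_iff_AE)
       (auto intro!: sq_integrable_square sq_integrable_diff us w)
  then show ?thesis
  proof eventually_elim
    case (elim x)
    then show ?case using cB[of "us x"] by simp
  qed
qed

end

section \<open>The uniform measure and the cell partition\<close>

text \<open>Restricted Lebesgue measure with the plain Borel sets of the whole space. Measurability
  then does not depend on \<open>A\<close>, and products of such measures are again of this form,
  neither of which holds for \<open>lebesgue_on\<close>. There is no normalization: it is a
  probability measure only if \<open>A\<close> has measure 1.\<close>

definition uniform_on :: "'a::euclidean_space set \<Rightarrow> 'a measure"
  where "uniform_on A = density lborel (indicator A)"

lemma sets_uniform_on [simp, measurable_cong]: "sets (uniform_on A) = sets borel"
  by (simp add: uniform_on_def)

lemma space_uniform_on [simp]: "space (uniform_on A) = UNIV"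
  by (simp add: uniform_on_def)

lemma borel_measurable_uniform_on [simp]:
  "borel_measurable (uniform_on A) = borel_measurable borel"
  by (rule measurable_cong_sets) auto

lemma AE_uniform_on:
  assumes "A \<in> sets borel"
  shows "(AE x in uniform_on A. P x) \<longleftrightarrow> (AE x in lborel. x \<in> A \<longrightarrow> P x)"
  unfolding uniform_on_def using assms by (subst AE_density) (auto simp: indicator_def)

lemma emeasure_uniform_on:
  assumes "A \<in> sets borel" "B \<in> sets borel"
  shows "emeasure (uniform_on A) B = emeasure lborel (A \<inter> B)"
  unfolding uniform_on_def using assms
  by (subst emeasure_density) (auto simp flip: indicator_inter_arith)

lemma integral_uniform_on:
  fixes f :: "'a::euclidean_space \<Rightarrow> real"
  assumes "A \<in> sets borel" "f \<in> borel_measurable borel"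
  shows "integral\<^sup>L (uniform_on A) f = (\<integral>x. indicator A x * f x \<partial>lborel)"
    and "integrable (uniform_on A) f \<longleftrightarrow> integrable lborel (\<lambda>x. indicator A x * f x)"
proof -
  have D: "uniform_on A = density lborel (\<lambda>x. ennreal (indicator A x))"
    by (simp add: uniform_on_def ennreal_indicator)
  show "integral\<^sup>L (uniform_on A) f = (\<integral>x. indicator A x * f x \<partial>lborel)"
    unfolding D using assms by (subst integral_density) auto
  show "integrable (uniform_on A) f \<longleftrightarrow> integrable lborel (\<lambda>x. indicator A x * f x)"
    unfolding D using assms by (subst integrable_density) auto
qed

text \<open>Completeness makes a set measurable once it agrees a.e. with a measurable one; this is
  applied to preimages.\<close>

lemma (in complete_measure) borel_measurable_AE_eq:
  fixes f f' :: "'a \<Rightarrow> real"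
  assumes f': "f' \<in> borel_measurable M" and ae: "AE x in M. f x = f' x"
  shows "f \<in> borel_measurable M"
proof (rule measurableI)
  fix A :: "real set" assume A: "A \<in> sets borel"
  show "f -` A \<inter> space M \<in> sets M"
  proof (rule in_sets_AE)
    show "AE x in M. x \<in> f' -` A \<inter> space M \<longleftrightarrow> x \<in> f -` A \<inter> space M"
      using ae by eventually_elim auto
    show "f' -` A \<inter> space M \<in> sets M"
      using f' A by (rule measurable_sets)
  qed auto
qed auto

text \<open>The bridge from the notions of the statement to Borel ones. Multiplication by the
  indicator of \<open>A\<close> moves both functions to the whole space, where completing the
  measure changes neither integrability nor integral.\<close>

lemma lebesgue_on_eq_uniform_on:
  fixes f f' :: "'a::euclidean_space \<Rightarrow> real"
  assumes A: "A \<in> sets borel" and f': "f' \<in> borel_measurable borel"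
    and ae: "AE x in uniform_on A. f x = f' x"
  shows "f \<in> borel_measurable (lebesgue_on A)"
    and "integrable (lebesgue_on A) f \<longleftrightarrow> integrable (uniform_on A) f'"
    and "integral\<^sup>L (lebesgue_on A) f = integral\<^sup>L (uniform_on A) f'"
proof -
  let ?f = "\<lambda>x. indicator A x * f x" and ?f' = "\<lambda>x. indicator A x * f' x"
  have ae': "AE x in lebesgue. ?f x = ?f' x"
    using ae unfolding AE_uniform_on[OF A] AE_completion_iff
    by eventually_elim (auto simp: indicator_def)
  have m': "?f' \<in> borel_measurable lborel"
    using A f' by simp
  have m: "?f \<in> borel_measurable lebesgue"
    by (rule completion.borel_measurable_AE_eq[OF measurable_completion[OF m'] ae'])
  have mc: "?f' \<in> borel_measurable lebesgue"
    by (rule measurable_completion[OF m'])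
  have AL: "A \<inter> space lebesgue \<in> sets lebesgue"
    using A by auto
  show "f \<in> borel_measurable (lebesgue_on A)"
    by (subst borel_measurable_restrict_space_iff[OF AL]) (use m in \<open>simp add: mult.commute\<close>)
  show "integrable (lebesgue_on A) f \<longleftrightarrow> integrable (uniform_on A) f'"
    unfolding integral_uniform_on(2)[OF A f'] integrable_restrict_space[OF AL]
    using integrable_cong_AE[OF m mc ae'] integrable_completion[OF m'] by simp
  show "integral\<^sup>L (lebesgue_on A) f = integral\<^sup>L (uniform_on A) f'"
    unfolding integral_uniform_on(1)[OF A f'] integral_restrict_space[OF AL]
    using integral_cong_AE[OF m mc ae'] integral_completion[OF m'] by simp
qed

lemma borel_representative:
  fixes f :: "'a::euclidean_space \<Rightarrow> real"
  assumes A: "A \<in> sets borel" and f: "f \<in> borel_measurable (lebesgue_on A)"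
  obtains f' where "f' \<in> borel_measurable borel" "AE x in uniform_on A. f x = f' x"
proof -
  have "A \<inter> space lebesgue \<in> sets lebesgue"
    using A by auto
  from borel_measurable_restrict_space_iff[OF this, of f] f
  have "(\<lambda>x. indicator A x * f x) \<in> borel_measurable lebesgue"
    by (simp add: mult.commute)
  from completion_ex_borel_measurable_real[OF this]
  obtain f' where f': "f' \<in> borel_measurable lborel" "AE x in lborel. indicator A x * f x = f' x"
    by auto
  then have "AE x in uniform_on A. f x = f' x"
    unfolding AE_uniform_on[OF A] by (auto elim!: eventually_mono)
  then show ?thesis
    using that f' by auto
qed

lemma finite_measure_uniform_on:
  assumes "A \<in> sets borel" "emeasure lborel A \<noteq> \<infinity>"
  shows "finite_measure (uniform_on A)"
  using assms by (intro finite_measureI) (simp add: emeasure_uniform_on)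

lemma uniform_on_Times:
  fixes A :: "'a::euclidean_space set" and B :: "'b::euclidean_space set"
  assumes A: "A \<in> sets borel" and B: "B \<in> sets borel" "emeasure lborel B \<noteq> \<infinity>"
  shows "uniform_on A \<Otimes>\<^sub>M uniform_on B = uniform_on (A \<times> B)"
proof -
  interpret B: finite_measure "uniform_on B"
    by (rule finite_measure_uniform_on[OF B])
  have "sigma_finite_measure (uniform_on B)" ..
  then have "uniform_on A \<Otimes>\<^sub>M uniform_on B
      = density (lborel \<Otimes>\<^sub>M lborel) (\<lambda>(x, y). indicator A x * indicator B y)"
    unfolding uniform_on_def
    by (intro pair_measure_density lborel.sigma_finite_measure_axioms) (use A B in auto)
  also have "(\<lambda>(x, y). indicator A x * indicator B y) = (indicator (A \<times> B) :: 'a \<times> 'b \<Rightarrow> ennreal)"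
    by (auto simp: fun_eq_iff indicator_def)
  finally show ?thesis
    by (simp add: uniform_on_def lborel_prod)
qed

section \<open>The unit interval as a probability space, Jensen's inequality, and the cells\<close>

abbreviation unit_measure :: "real measure"
  where "unit_measure \<equiv> uniform_on Omega"

lemma prob_space_unit_measure: "prob_space unit_measure"
  by (rule prob_spaceI) (simp add: emeasure_uniform_on)

interpretation unit: prob_space unit_measure
  by (rule prob_space_unit_measure)

interpretation unit_pair: pair_prob_space unit_measure unit_measure ..

lemma unit_measure_pair: "unit_measure \<Otimes>\<^sub>M unit_measure = uniform_on (Omega \<times> Omega)"
  by (rule uniform_on_Times) auto

text \<open>Jensen for the uniform probability on \<open>C\<close>, whose density is the indicator
  of \<open>C\<close> over its measure. The factor \<open>measure M C\<close> stays in front so that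
  the inequalities for the sets of a partition can be summed.\<close>

lemma (in finite_measure) jensen_on_set:
  fixes f :: "'a \<Rightarrow> real"
  assumes C [measurable]: "C \<in> sets M" and pos: "measure M C > 0"
    and f: "integrable M f" and q: "convex_on UNIV q" and qf: "integrable M (\<lambda>x. q (f x))"
  shows "measure M C * q ((\<integral>x. indicator C x * f x \<partial>M) / measure M C)
    \<le> (\<integral>x. indicator C x * q (f x) \<partial>M)"
proof -
  define c where "c = measure M C"
  define N where "N = uniform_measure M C"
  have em: "emeasure M C = ennreal c"
    by (simp add: c_def emeasure_eq_measure)
  have "indicator C x / ennreal c = ennreal (indicator C x / c)" for x
    using divide_ennreal[of 1 c] pos by (cases "x \<in> C") (simp_all add: c_def)
  then have N: "N = density M (\<lambda>x. ennreal (indicator C x / c))"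
    unfolding N_def uniform_measure_def em by simp
  interpret N: prob_space N
    unfolding N_def using pos by (intro prob_space_uniform_measure) (auto simp: em c_def)
  have int: "integrable N h" "N.expectation h = (\<integral>x. indicator C x * h x \<partial>M) / c"
    if h: "integrable M h" for h :: "'a \<Rightarrow> real"
  proof -
    have "integrable M (\<lambda>x. indicator C x * h x)"
      using integrable_real_mult_indicator[OF C h] by (simp add: mult.commute)
    then have "integrable M (\<lambda>x. indicator C x * h x / c)"
      by simp
    then show "integrable N h"
      unfolding N using h pos by (subst integrable_density) (auto simp: c_def)
    have "N.expectation h = (\<integral>x. indicator C x * h x / c \<partial>M)"
      unfolding N using h pos by (subst integral_density) (auto simp: c_def)
    then show "N.expectation h = (\<integral>x. indicator C x * h x \<partial>M) / c"
      by simp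
  qed
  have "q (N.expectation f) \<le> N.expectation (\<lambda>x. q (f x))"
    by (rule N.jensens_inequality[where I=UNIV]) (auto intro: int f qf q)
  then show ?thesis
    unfolding int(2)[OF f] int(2)[OF qf] using pos by (simp add: c_def field_simps)
qed

text \<open>Disjointness and covering of the cells become uniqueness and existence of the floor. The
  shift by 1 is due to the cells being numbered from 1.\<close>

lemma cell_iff_floor:
  assumes "n \<ge> 1" "i \<ge> 1"
  shows "x \<in> cell n i \<longleftrightarrow> \<lfloor>real n * x\<rfloor> = int i - 1"
proof -
  have "x \<in> cell n i \<longleftrightarrow> real i - 1 \<le> real n * x \<and> real n * x < real i"
    using assms by (auto simp: cell_def field_simps)
  also have "\<dots> \<longleftrightarrow> \<lfloor>real n * x\<rfloor> = int i - 1"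
    by (subst floor_eq_iff) auto
  finally show ?thesis .
qed

lemma cell_unique:
  assumes "n \<ge> 1" "i \<ge> 1" "j \<ge> 1" "x \<in> cell n i" "x \<in> cell n j"
  shows "i = j"
  using assms by (auto simp: cell_iff_floor)

lemma cell_exists:
  assumes "n \<ge> 1" "0 \<le> x" "x < 1"
  obtains i where "i \<in> {1..n}" "x \<in> cell n i"
proof
  have "0 \<le> real n * x" "real n * x < real n"
    using assms by auto
  then have fl: "0 \<le> \<lfloor>real n * x\<rfloor>" "\<lfloor>real n * x\<rfloor> < int n"
    by (auto simp: floor_less_iff)
  then show i: "nat \<lfloor>real n * x\<rfloor> + 1 \<in> {1..n}"
    using assms(1) by auto
  show "x \<in> cell n (nat \<lfloor>real n * x\<rfloor> + 1)"
    using fl by (subst cell_iff_floor[OF assms(1)]) auto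
qed

lemma cell_subset:
  assumes "n \<ge> 1" "i \<in> {1..n}"
  shows "cell n i \<subseteq> {0..<1}"
proof
  fix x assume x: "x \<in> cell n i"
  have "0 \<le> (real i - 1) / real n" "real i / real n \<le> 1"
    using assms by auto
  with x show "x \<in> {0..<1}"
    by (auto simp: cell_def)
qed

lemma cell_borel [measurable]: "cell n i \<in> sets borel"
  by (simp add: cell_def)

lemma measure_cell:
  assumes "n \<ge> 1" "i \<in> {1..n}"
  shows "measure unit_measure (cell n i) = 1 / real n"
proof -
  have "Omega \<inter> cell n i = cell n i"
    using cell_subset[OF assms] by auto
  moreover have "emeasure lborel (cell n i) = ennreal (1 / real n)"
    unfolding cell_def using assms by (subst emeasure_lborel_Ico) (auto simp: field_simps)
  ultimately show ?thesis
    by (simp add: measure_def emeasure_uniform_on)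
qed

text \<open>The half-open cells miss the right endpoint of \<open>Omega\<close>, hence all arguments
  that locate a point in a cell are a.e. arguments.\<close>

lemma AE_unit_measure_lt_1: "AE x in unit_measure. 0 \<le> x \<and> x < 1"
proof -
  have "AE x in lborel. x \<noteq> (1::real)"
    by (rule AE_lborel_singleton)
  then show ?thesis
    by (simp add: AE_uniform_on) (auto elim!: eventually_mono)
qed

lemma step_fun_cell:
  assumes "n \<ge> 1" "i \<in> {1..n}" "x \<in> cell n i"
  shows "step_fun n v x = v i"
proof -
  have "v j * indicator (cell n j) x = (if j = i then v i else 0)" if "j \<in> {1..n}" for j
  proof (cases "j = i")
    case False
    then have "x \<notin> cell n j"
      using that assms cell_unique[of n i j x] by auto
    with False show ?thesis by simp
  qed (use assms in simp)
  then have "step_fun n v x = (\<Sum>j=1..n. if j = i then v i else 0)"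
    unfolding step_fun_def by (intro sum.cong) auto
  then show ?thesis
    using assms by simp
qed

lemma step_fun_borel [measurable]: "step_fun n v \<in> borel_measurable borel"
  unfolding step_fun_def by measurable

lemma integral_unit_split:
  fixes f :: "real \<Rightarrow> real"
  assumes n: "n \<ge> 1" and f: "integrable unit_measure f"
  shows "(\<integral>x. f x \<partial>unit_measure) = (\<Sum>i=1..n. \<integral>x. indicator (cell n i) x * f x \<partial>unit_measure)"
proof -
  \<comment> \<open>The indicators of the cells form a partition of unity off the point 1.\<close>
  have one: "step_fun n (\<lambda>_. 1) x = 1" if "0 \<le> x" "x < 1" for x
    using cell_exists[OF n that] step_fun_cell[OF n] by metis
  have [measurable]: "f \<in> borel_measurable borel"
    using borel_measurable_integrable[OF f] by simp
  have int: "integrable unit_measure (\<lambda>x. indicator (cell n i) x * f x)" for i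
    using integrable_real_mult_indicator[OF _ f, of "cell n i"] by (simp add: mult.commute)
  have "(\<integral>x. f x \<partial>unit_measure) = (\<integral>x. (\<Sum>i=1..n. indicator (cell n i) x * f x) \<partial>unit_measure)"
  proof (rule integral_cong_AE)
    show "AE x in unit_measure. f x = (\<Sum>i=1..n. indicator (cell n i) x * f x)"
      using AE_unit_measure_lt_1
    proof eventually_elim
      case (elim x)
      then show ?case
        using one[of x] by (simp add: step_fun_def flip: sum_distrib_right)
    qed
  qed auto
  also have "\<dots> = (\<Sum>i=1..n. \<integral>x. indicator (cell n i) x * f x \<partial>unit_measure)"
    by (rule Bochner_Integration.integral_sum) (rule int)
  finally show ?thesis .
qed

text \<open>Averages see only the a.e. class, so a Borel representative may be used; for Borel
  \<open>f\<close> the lemma is applied with \<open>f' = f\<close>, to rewrite the average over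
  \<open>unit_measure\<close>.\<close>

lemma cell_avg_eq:
  assumes n: "n \<ge> 1" "i \<in> {1..n}" and f': "f' \<in> borel_measurable borel"
    and ae: "AE x in unit_measure. f x = f' x"
  shows "cell_avg f n i = real n * (\<integral>x. indicator (cell n i) x * f' x \<partial>unit_measure)"
proof -
  have sub: "cell n i \<subseteq> Omega"
    using cell_subset[OF n] by auto
  have "AE x in uniform_on (cell n i). f x = f' x"
    using ae sub by (auto simp: AE_uniform_on elim!: eventually_mono)
  then have "integral\<^sup>L (lebesgue_on (cell n i)) f = integral\<^sup>L (uniform_on (cell n i)) f'"
    using f' by (intro lebesgue_on_eq_uniform_on) auto
  also have "\<dots> = (\<integral>x. indicator (cell n i) x * f' x \<partial>lborel)"
    using f' by (intro integral_uniform_on) auto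
  also have "\<dots> = (\<integral>x. indicator Omega x * (indicator (cell n i) x * f' x) \<partial>lborel)"
    using sub by (intro Bochner_Integration.integral_cong) (auto simp: indicator_def)
  also have "\<dots> = (\<integral>x. indicator (cell n i) x * f' x \<partial>unit_measure)"
    using f' by (intro integral_uniform_on(1)[symmetric]) auto
  finally show ?thesis
    by (simp add: cell_avg_def)
qed

lemma integrable_indicator_mult:
  fixes f :: "'a \<Rightarrow> real"
  assumes "A \<in> sets M" "integrable M f"
  shows "integrable M (\<lambda>x. indicator A x * f x)"
  using integrable_real_mult_indicator[OF assms] by (simp add: mult.commute)

lemma (in pair_sigma_finite) integral_product_mult:
  fixes f :: "'a \<Rightarrow> real" and h :: "'b \<Rightarrow> real"
  assumes f [measurable]: "integrable M1 f" and h [measurable]: "integrable M2 h"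
  shows "integrable (M1 \<Otimes>\<^sub>M M2) (\<lambda>z. f (fst z) * h (snd z))"
    and "(\<integral>z. f (fst z) * h (snd z) \<partial>(M1 \<Otimes>\<^sub>M M2)) = (\<integral>x. f x \<partial>M1) * (\<integral>x. h x \<partial>M2)"
proof -
  show int: "integrable (M1 \<Otimes>\<^sub>M M2) (\<lambda>z. f (fst z) * h (snd z))"
  proof (rule Fubini_integrable)
    show "integrable M1 (\<lambda>x. \<integral>y. norm (f (fst (x, y)) * h (snd (x, y))) \<partial>M2)"
      using f by (simp add: abs_mult)
    show "AE x in M1. integrable M2 (\<lambda>y. f (fst (x, y)) * h (snd (x, y)))"
      using h by simp
  qed measurable
  show "(\<integral>z. f (fst z) * h (snd z) \<partial>(M1 \<Otimes>\<^sub>M M2)) = (\<integral>x. f x \<partial>M1) * (\<integral>x. h x \<partial>M2)"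
    using integral_fst'[OF int] by simp
qed

section \<open>Cell averages and step functions\<close>

lemma integral_cell_const:
  assumes "n \<ge> 1" "i \<in> {1..n}"
  shows "(\<integral>x. indicator (cell n i) x * (c::real) \<partial>unit_measure) = c / real n"
  using measure_cell[OF assms] by simp

lemma sq_integrable_step_fun: "step_fun n v \<in> sq_integrable unit_measure"
proof -
  have "\<bar>step_fun n v x\<bar> \<le> (\<Sum>i=1..n. \<bar>v i\<bar>)" for x
    unfolding step_fun_def
    by (rule order_trans[OF sum_abs], rule sum_mono) (simp add: abs_mult indicator_def)
  then show ?thesis
    by (intro unit.sq_integrable_bounded[of _ "\<Sum>i=1..n. \<bar>v i\<bar>"]) auto
qed

text \<open>Pythagoras for the orthogonal projection onto step functions: on each cell,
  \<open>f\<close> minus its average is orthogonal to constants. It turns the fidelity of a step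
  function into the discrete fidelity plus a term independent of \<open>v\<close>, and shows that
  cell averages are the best step approximation.\<close>

lemma step_fun_pythagoras:
  assumes n: "n \<ge> 1" and f: "f \<in> sq_integrable unit_measure"
  shows "(\<integral>x. (step_fun n v x - f x)\<^sup>2 \<partial>unit_measure)
    = 1 / real n * (\<Sum>i=1..n. (v i - cell_avg f n i)\<^sup>2)
      + (\<integral>x. (step_fun n (cell_avg f n) x - f x)\<^sup>2 \<partial>unit_measure)"
proof -
  have [measurable]: "f \<in> borel_measurable borel"
    using f by (auto simp: sq_integrable_def)
  have f1: "integrable unit_measure f" and f2: "integrable unit_measure (\<lambda>x. (f x)\<^sup>2)"
    using unit.sq_integrable_integrable[OF f] sq_integrable_square[OF f] .
  define b where "b i = (\<integral>x. indicator (cell n i) x * (f x)\<^sup>2 \<partial>unit_measure)" for i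
  have avg: "(\<integral>x. indicator (cell n i) x * f x \<partial>unit_measure) = cell_avg f n i / real n"
    if i: "i \<in> {1..n}" for i
    using cell_avg_eq[OF n i, of f f] n by simp
  \<comment> \<open>On a cell the integral is a quadratic in the value \<open>w i\<close> whose
    constant term \<open>b i\<close> does not depend on \<open>w\<close>. It therefore cancels when
    \<open>w\<close> is taken to be \<open>v\<close> and to be the cell averages.\<close>
  have cell: "(\<integral>x. indicator (cell n i) x * (step_fun n w x - f x)\<^sup>2 \<partial>unit_measure)
      = ((w i)\<^sup>2 - 2 * w i * cell_avg f n i) / real n + b i" if i: "i \<in> {1..n}" for i w
  proof -
    have "(\<integral>x. indicator (cell n i) x * (step_fun n w x - f x)\<^sup>2 \<partial>unit_measure)
        = (\<integral>x. indicator (cell n i) x * (w i)\<^sup>2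
            - 2 * w i * (indicator (cell n i) x * f x) + indicator (cell n i) x * (f x)\<^sup>2 \<partial>unit_measure)"
      using step_fun_cell[OF n i]
      by (intro Bochner_Integration.integral_cong) (auto simp: indicator_def power2_diff)
    also have "\<dots> = (\<integral>x. indicator (cell n i) x * (w i)\<^sup>2 \<partial>unit_measure)
        - 2 * w i * (\<integral>x. indicator (cell n i) x * f x \<partial>unit_measure) + b i"
      using integrable_indicator_mult[OF _ f1, of "cell n i"] integrable_indicator_mult[OF _ f2, of "cell n i"]
        integrable_indicator_mult[OF _ unit.integrable_const, of "cell n i" "(w i)\<^sup>2"]
      unfolding b_def
      by (subst Bochner_Integration.integral_add Bochner_Integration.integral_diff integral_mult_right_zero; simp?)+
    also have "\<dots> = (w i)\<^sup>2 / real n - 2 * w i * (cell_avg f n i / real n) + b i"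
      unfolding integral_cell_const[OF n i] avg[OF i] ..
    finally show ?thesis
      by (simp add: diff_divide_distrib)
  qed
  have split: "(\<integral>x. (step_fun n w x - f x)\<^sup>2 \<partial>unit_measure)
      = (\<Sum>i=1..n. ((w i)\<^sup>2 - 2 * w i * cell_avg f n i) / real n + b i)" for w
    using integral_unit_split[OF n sq_integrable_square[OF sq_integrable_diff[OF sq_integrable_step_fun f]]]
    by (simp add: cell)
  show ?thesis
    unfolding split sum_distrib_left sum.distrib[symmetric]
    by (intro sum.cong) (auto simp: power2_eq_square field_simps)
qed

lemma cell_avg_diff:
  assumes n: "n \<ge> 1" "i \<in> {1..n}" and f: "f \<in> sq_integrable unit_measure" and h: "h \<in> sq_integrable unit_measure"
  shows "cell_avg (\<lambda>x. f x - h x) n i = cell_avg f n i - cell_avg h n i"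
proof -
  have [measurable]: "f \<in> borel_measurable borel" "h \<in> borel_measurable borel"
    using f h by (auto simp: sq_integrable_def)
  have int: "integrable unit_measure (\<lambda>x. indicator (cell n i) x * f x)"
    "integrable unit_measure (\<lambda>x. indicator (cell n i) x * h x)"
    by (intro integrable_indicator_mult unit.sq_integrable_integrable f h; simp)+
  have "cell_avg (\<lambda>x. f x - h x) n i
      = real n * (\<integral>x. indicator (cell n i) x * f x - indicator (cell n i) x * h x \<partial>unit_measure)"
    by (subst cell_avg_eq[OF n, of "\<lambda>x. f x - h x"]) (auto simp: algebra_simps)
  also have "\<dots> = cell_avg f n i - cell_avg h n i"
    using int by (simp add: cell_avg_eq[OF n, of f f] cell_avg_eq[OF n, of h h] right_diff_distrib)
  finally show ?thesis .
qed

text \<open>Jensen for the square on each cell, then summation: projecting does not increase the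
  fidelity term.\<close>

lemma sum_cell_avg_square_le:
  assumes n: "n \<ge> 1" and f: "f \<in> sq_integrable unit_measure"
  shows "1 / real n * (\<Sum>i=1..n. (cell_avg f n i)\<^sup>2) \<le> (\<integral>x. (f x)\<^sup>2 \<partial>unit_measure)"
proof -
  have [measurable]: "f \<in> borel_measurable borel"
    using f by (auto simp: sq_integrable_def)
  have "1 / real n * (cell_avg f n i)\<^sup>2 \<le> (\<integral>x. indicator (cell n i) x * (f x)\<^sup>2 \<partial>unit_measure)"
    if i: "i \<in> {1..n}" for i
  proof -
    have "convex_on UNIV (\<lambda>x::real. x\<^sup>2)"
      by (intro convex_on_realI[of _ _ "\<lambda>x. 2 * x"]) (auto intro!: derivative_eq_intros)
    from unit.jensen_on_set[OF _ _ unit.sq_integrable_integrable[OF f] this sq_integrable_square[OF f], of "cell n i"]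
    show ?thesis
      using n cell_avg_eq[OF n i, of f f] by (simp add: measure_cell[OF n i] mult.commute)
  qed
  then have "(\<Sum>i=1..n. 1 / real n * (cell_avg f n i)\<^sup>2)
      \<le> (\<Sum>i=1..n. \<integral>x. indicator (cell n i) x * (f x)\<^sup>2 \<partial>unit_measure)"
    by (rule sum_mono)
  then show ?thesis
    using integral_unit_split[OF n sq_integrable_square[OF f]] by (simp add: sum_distrib_left)
qed

lemma measure_cell_Times:
  assumes n: "n \<ge> 1" "i \<in> {1..n}" "j \<in> {1..n}"
  shows "measure (unit_measure \<Otimes>\<^sub>M unit_measure) (cell n i \<times> cell n j) = 1 / (real n)\<^sup>2"
  using measure_cell[OF n(1,2)] measure_cell[OF n(1,3)]
  
  by (simp add: measure_def unit.emeasure_pair_measure_Times enn2real_mult power2_eq_square)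

lemma cell_Times_in_sets [measurable]:
  "cell n i \<times> cell n j \<in> sets (unit_measure \<Otimes>\<^sub>M unit_measure)"
  by (intro pair_measureI) auto

text \<open>Jensen on a square of cells for the function (x, y) \<mapsto> f y - f x, whose average
  there is the difference of the two cell averages.\<close>

lemma cell_powr_diff_le:
  assumes n: "n \<ge> 1" "i \<in> {1..n}" "j \<in> {1..n}" and p: "1 \<le> p" "p \<le> 2"
    and f: "f \<in> sq_integrable unit_measure"
  shows "1 / (real n)\<^sup>2 * \<bar>cell_avg f n j - cell_avg f n i\<bar> powr p
    \<le> (\<integral>z. indicator (cell n i \<times> cell n j) z * \<bar>f (snd z) - f (fst z)\<bar> powr p
          \<partial>(unit_measure \<Otimes>\<^sub>M unit_measure))"
proof -
  interpret kernel_problem unit_measure 1 p f "\<lambda>_. 1"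
    using p f by unfold_locales auto
  let ?C = "cell n i \<times> cell n j" and ?M = "unit_measure \<Otimes>\<^sub>M unit_measure"
  have [measurable]: "f \<in> borel_measurable borel"
    using f by (auto simp: sq_integrable_def)
  have fint: "integrable unit_measure f"
    by (rule unit.sq_integrable_integrable[OF f])
  have fi: "integrable ?M (\<lambda>z. f (fst z))" "integrable ?M (\<lambda>z. f (snd z))"
    using integrable_pair_fst[OF fint] by auto
  have ind: "integrable unit_measure (indicator (cell n k) :: real \<Rightarrow> real)"
      "integrable unit_measure (\<lambda>x. indicator (cell n k) x * f x)" for k
    using integrable_indicator_mult[OF _ fint, of "cell n k"]
      integrable_indicator_mult[OF _ unit.integrable_const[of 1], of "cell n k"] by auto
  have ij: "(\<integral>x. indicator (cell n k) x \<partial>unit_measure) = 1 / real n"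
     "(\<integral>x. indicator (cell n k) x * f x \<partial>unit_measure) = cell_avg f n k / real n"
     if "k \<in> {1..n}" for k
    using that integral_cell_const[OF n(1) that, of 1] cell_avg_eq[OF n(1) that, of f f] n(1) by auto
  \<comment> \<open>A difference of products of one-variable functions, so that each double integral
    factorizes.\<close>
  have "(\<integral>z. indicator ?C z * (f (snd z) - f (fst z)) \<partial>?M)
      = (\<integral>z. indicator (cell n i) (fst z) * (indicator (cell n j) (snd z) * f (snd z))
           - (indicator (cell n i) (fst z) * f (fst z)) * indicator (cell n j) (snd z) \<partial>?M)"
    by (intro Bochner_Integration.integral_cong) (auto simp: indicator_def)
  also have "\<dots> = 1 / real n * (cell_avg f n j / real n) - cell_avg f n i / real n * (1 / real n)"
    using unit_pair.integral_product_mult[OF ind(1)[of i] ind(2)[of j]]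
      unit_pair.integral_product_mult[OF ind(2)[of i] ind(1)[of j]]
    unfolding ij[OF n(2)] ij[OF n(3)] by (subst Bochner_Integration.integral_diff) auto
  also have "\<dots> = 1 / (real n)\<^sup>2 * (cell_avg f n j - cell_avg f n i)"
    by (simp add: power2_eq_square diff_divide_distrib)
  finally have avg: "(\<integral>z. indicator ?C z * (f (snd z) - f (fst z)) \<partial>?M)
      = 1 / (real n)\<^sup>2 * (cell_avg f n j - cell_avg f n i)" .
  have "measure ?M ?C * \<bar>(\<integral>z. indicator ?C z * (f (snd z) - f (fst z)) \<partial>?M) / measure ?M ?C\<bar> powr p
      \<le> (\<integral>z. indicator ?C z * \<bar>f (snd z) - f (fst z)\<bar> powr p \<partial>?M)"
    using n fi
    by (intro unit_pair.jensen_on_set convex_on_abs_powr p integrable_powr_diff f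
        Bochner_Integration.integrable_diff) (auto simp: measure_cell_Times)
  then show ?thesis
    unfolding avg measure_cell_Times[OF n] using n by simp
qed

text \<open>The existential becomes a sum because the squares are disjoint: at most one summand is
  nonzero at a given point.\<close>

lemma graph_kernel_sum:
  assumes n: "n \<ge> 1" and E: "E \<subseteq> {1..n} \<times> {1..n}"
  shows "graph_kernel n E z = (\<Sum>(i, j)\<in>E. indicator (cell n i \<times> cell n j) z)"
proof (cases "\<exists>(i, j)\<in>E. z \<in> cell n i \<times> cell n j")
  case True
  then obtain i j where ij: "(i, j) \<in> E" "z \<in> cell n i \<times> cell n j"
    by auto
  have "indicator (cell n (fst e) \<times> cell n (snd e)) z = (if e = (i, j) then 1 else (0::real))" if "e \<in> E" for e
  proof (cases "z \<in> cell n (fst e) \<times> cell n (snd e)")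
    case True
    moreover have "fst e \<ge> 1" "snd e \<ge> 1" "i \<ge> 1" "j \<ge> 1"
      using that ij E by auto
    ultimately have "fst e = i" "snd e = j"
      using ij cell_unique[OF n, of "fst e" i "fst z"] cell_unique[OF n, of "snd e" j "snd z"] by auto
    with True show ?thesis by (auto simp: prod_eq_iff)
  next
    case False
    with ij show ?thesis by auto
  qed
  then have "(\<Sum>e\<in>E. indicator (cell n (fst e) \<times> cell n (snd e)) z) = (\<Sum>e\<in>E. if e = (i, j) then 1 else (0::real))"
    by (rule sum.cong[OF refl])
  also have "\<dots> = 1"
    using ij finite_subset[OF E] by simp
  finally show ?thesis
    using True by (simp add: graph_kernel_def case_prod_beta')
next
  case False
  then have "(\<Sum>(i, j)\<in>E. indicator (cell n i \<times> cell n j) z) = (0::real)"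
    by (intro sum.neutral) (auto simp: indicator_def)
  with False show ?thesis
    by (simp add: graph_kernel_def)
qed

lemma graph_kernel_measurable:
  assumes "n \<ge> 1" "E \<subseteq> {1..n} \<times> {1..n}"
  shows "graph_kernel n E \<in> borel_measurable (unit_measure \<Otimes>\<^sub>M unit_measure)"
proof -
  have "graph_kernel n E = (\<lambda>z. \<Sum>e\<in>E. indicator (cell n (fst e) \<times> cell n (snd e)) z)"
    using graph_kernel_sum[OF assms] by (simp add: fun_eq_iff case_prod_beta')
  also have "\<dots> \<in> borel_measurable (unit_measure \<Otimes>\<^sub>M unit_measure)"
    by (intro borel_measurable_sum borel_measurable_indicator cell_Times_in_sets)
  finally show ?thesis .
qed

lemma dirichlet_graph_kernel:
  assumes n: "n \<ge> 1" and E: "E \<subseteq> {1..n} \<times> {1..n}" and p: "1 \<le> p" "p \<le> 2"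
    and f: "f \<in> sq_integrable unit_measure"
  shows "dirichlet unit_measure p (graph_kernel n E) f
    = (\<Sum>(i, j)\<in>E. \<integral>z. indicator (cell n i \<times> cell n j) z * \<bar>f (snd z) - f (fst z)\<bar> powr p
          \<partial>(unit_measure \<Otimes>\<^sub>M unit_measure))"
proof -
  interpret kernel_problem unit_measure 1 p f "\<lambda>_. 1"
    using p f by unfold_locales auto
  have "integrable (unit_measure \<Otimes>\<^sub>M unit_measure)
      (\<lambda>z. indicator (cell n i \<times> cell n j) z * \<bar>f (snd z) - f (fst z)\<bar> powr p)" for i j
    by (intro integrable_indicator_mult integrable_powr_diff f) auto
  then show ?thesis
    unfolding dirichlet_def graph_kernel_sum[OF n E] sum_distrib_right case_prod_beta
    by (intro Bochner_Integration.integral_sum) auto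
qed

lemma dirichlet_cell_avg_le:
  assumes n: "n \<ge> 1" and E: "E \<subseteq> {1..n} \<times> {1..n}" and p: "1 \<le> p" "p \<le> 2"
    and f: "f \<in> sq_integrable unit_measure"
  shows "1 / (real n)\<^sup>2 * (\<Sum>(i, j)\<in>E. \<bar>cell_avg f n j - cell_avg f n i\<bar> powr p)
    \<le> dirichlet unit_measure p (graph_kernel n E) f"
  unfolding dirichlet_graph_kernel[OF assms] sum_distrib_left case_prod_beta
  using E by (intro sum_mono cell_powr_diff_le p n f) auto

text \<open>A step function makes the integrand constant on every square, each of area 1 / n^2.
  Together with \<open>step_fun_pythagoras\<close> this identifies the discrete energy with the
  continuous one on step functions, up to a constant.\<close>

lemma dirichlet_step_fun:
  assumes n: "n \<ge> 1" and E: "E \<subseteq> {1..n} \<times> {1..n}" and p: "1 \<le> p" "p \<le> 2"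
  shows "dirichlet unit_measure p (graph_kernel n E) (step_fun n v)
    = 1 / (real n)\<^sup>2 * (\<Sum>(i, j)\<in>E. \<bar>v j - v i\<bar> powr p)"
proof -
  have "(\<integral>z. indicator (cell n i \<times> cell n j) z * \<bar>step_fun n v (snd z) - step_fun n v (fst z)\<bar> powr p
          \<partial>(unit_measure \<Otimes>\<^sub>M unit_measure)) = 1 / (real n)\<^sup>2 * \<bar>v j - v i\<bar> powr p"
    if ij: "i \<in> {1..n}" "j \<in> {1..n}" for i j
  proof -
    have "(\<integral>z. indicator (cell n i \<times> cell n j) z * \<bar>step_fun n v (snd z) - step_fun n v (fst z)\<bar> powr p
          \<partial>(unit_measure \<Otimes>\<^sub>M unit_measure))
       = (\<integral>z. indicator (cell n i \<times> cell n j) z * \<bar>v j - v i\<bar> powr p \<partial>(unit_measure \<Otimes>\<^sub>M unit_measure))"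
      using step_fun_cell[OF n] ij
      by (intro Bochner_Integration.integral_cong) (auto simp: indicator_def)
    then show ?thesis
      using measure_cell_Times[OF n ij] by simp
  qed
  then have "\<forall>e\<in>E. (\<integral>z. indicator (cell n (fst e) \<times> cell n (snd e)) z
        * \<bar>step_fun n v (snd z) - step_fun n v (fst z)\<bar> powr p \<partial>(unit_measure \<Otimes>\<^sub>M unit_measure))
      = 1 / (real n)\<^sup>2 * \<bar>v (snd e) - v (fst e)\<bar> powr p"
    using E by auto
  then show ?thesis
    unfolding dirichlet_graph_kernel[OF n E p sq_integrable_step_fun] sum_distrib_left case_prod_beta
    by (intro sum.cong) auto
qed

section \<open>The discretisation error\<close>

lemma graph_kernel_range: "0 \<le> graph_kernel n E z" "graph_kernel n E z \<le> 1"
  by (auto simp: graph_kernel_def)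

text \<open>With w the step function of \<open>u\<close> and c the projection error of
  \<open>g\<close> over 2 * lam, the chain is en k w \<le> en kn w = D u + c \<le> D (cell_avg us) +
  c \<le> en kn us + c. Subtracting en k us leaves on the right c and the kernel defect at
  \<open>us\<close>; strong convexity bounds the left side from below. The geometry of the graph
  enters only through k \<le> kn a.e.\<close>

lemma discretization_error:
  fixes k :: "real \<times> real \<Rightarrow> real"
  defines "D \<equiv> \<lambda>lam p g n E (v :: nat \<Rightarrow> real).
    1 / (2 * lam * real n) * (\<Sum>i=1..n. (v i - cell_avg g n i)\<^sup>2)
    + 1 / (2 * p * (real n)\<^sup>2) * (\<Sum>(i, j)\<in>E. \<bar>v j - v i\<bar> powr p)"
  assumes n: "n \<ge> 1" and E: "E \<subseteq> {1..n} \<times> {1..n}"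
    and kp: "kernel_problem unit_measure lam p g k"
    and us: "us \<in> sq_integrable unit_measure"
    and min: "\<And>v. v \<in> sq_integrable unit_measure
      \<Longrightarrow> kernel_energy unit_measure lam p g k us \<le> kernel_energy unit_measure lam p g k v"
    and le: "AE z in unit_measure \<Otimes>\<^sub>M unit_measure. k z \<le> graph_kernel n E z"
    and u: "\<And>v. D lam p g n E u \<le> D lam p g n E v"
  shows "(\<integral>x. (step_fun n u x - us x)\<^sup>2 \<partial>unit_measure)
    \<le> (\<integral>x. (step_fun n (cell_avg g n) x - g x)\<^sup>2 \<partial>unit_measure)
      + lam / p * (\<integral>z. (graph_kernel n E z - k z) * \<bar>us (snd z) - us (fst z)\<bar> powr p
          \<partial>(unit_measure \<Otimes>\<^sub>M unit_measure))"
proof -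
  interpret kernel_problem unit_measure lam p g k by fact
  interpret Kn: kernel_problem unit_measure lam p g "graph_kernel n E"
    using lam p g graph_kernel_measurable[OF n E] by unfold_locales (auto simp: graph_kernel_range)
  let ?en = "kernel_energy unit_measure lam p g" and ?kn = "graph_kernel n E"
  let ?P = "\<integral>x. (step_fun n (cell_avg g n) x - g x)\<^sup>2 \<partial>unit_measure"
  have dir_mono: "dirichlet unit_measure p k (step_fun n u) \<le> dirichlet unit_measure p ?kn (step_fun n u)"
    unfolding dirichlet_def
    by (intro integral_mono_AE integrable_dirichlet Kn.integrable_dirichlet sq_integrable_step_fun)
       (use le in \<open>eventually_elim, auto intro: mult_right_mono\<close>)
  have en_step: "?en ?kn (step_fun n u) = D lam p g n E u + 1 / (2 * lam) * ?P"
    unfolding kernel_energy_def D_def step_fun_pythagoras[OF n g, of u] dirichlet_step_fun[OF n E p]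
    by (simp add: distrib_left)
  have "(\<Sum>i=1..n. (cell_avg us n i - cell_avg g n i)\<^sup>2)
      = (\<Sum>i=1..n. (cell_avg (\<lambda>x. us x - g x) n i)\<^sup>2)"
    by (intro sum.cong) (simp_all add: cell_avg_diff[OF n _ us g])
  then have "1 / real n * (\<Sum>i=1..n. (cell_avg us n i - cell_avg g n i)\<^sup>2)
      \<le> (\<integral>x. (us x - g x)\<^sup>2 \<partial>unit_measure)"
    using sum_cell_avg_square_le[OF n sq_integrable_diff[OF us g]] by simp
  then have fid: "1 / (2 * lam) * (1 / real n * (\<Sum>i=1..n. (cell_avg us n i - cell_avg g n i)\<^sup>2))
      \<le> 1 / (2 * lam) * (\<integral>x. (us x - g x)\<^sup>2 \<partial>unit_measure)"
    using lam by (intro mult_left_mono) auto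
  have reg: "1 / (2 * p) * (1 / (real n)\<^sup>2 * (\<Sum>(i, j)\<in>E. \<bar>cell_avg us n j - cell_avg us n i\<bar> powr p))
      \<le> 1 / (2 * p) * dirichlet unit_measure p ?kn us"
    using dirichlet_cell_avg_le[OF n E p us] p by (intro mult_left_mono) auto
  have "D lam p g n E (cell_avg us n) \<le> ?en ?kn us"
    unfolding D_def kernel_energy_def using add_mono[OF fid reg] by (simp add: mult.assoc)
  moreover have "?en k (step_fun n u) \<le> ?en ?kn (step_fun n u)"
    unfolding kernel_energy_def using dir_mono p by (intro add_left_mono mult_left_mono) auto
  ultimately have "?en k (step_fun n u) \<le> ?en ?kn us + 1 / (2 * lam) * ?P"
    using u[of "cell_avg us n"] en_step by linarith
  moreover have "1 / (2 * lam) * (\<integral>x. (step_fun n u x - us x)\<^sup>2 \<partial>unit_measure)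
      \<le> ?en k (step_fun n u) - ?en k us"
    by (rule minimizer_strong_convexity[OF us sq_integrable_step_fun min])
  moreover have "?en ?kn us - ?en k us = 1 / (2 * p)
      * (\<integral>z. (?kn z - k z) * \<bar>us (snd z) - us (fst z)\<bar> powr p \<partial>(unit_measure \<Otimes>\<^sub>M unit_measure))"
  proof -
    have "dirichlet unit_measure p ?kn us - dirichlet unit_measure p k us
      = (\<integral>z. (?kn z - k z) * \<bar>us (snd z) - us (fst z)\<bar> powr p \<partial>(unit_measure \<Otimes>\<^sub>M unit_measure))"
      unfolding dirichlet_def left_diff_distrib
      by (rule Bochner_Integration.integral_diff[symmetric])
         (intro integrable_dirichlet Kn.integrable_dirichlet us)+
    then show ?thesis
      by (simp add: kernel_energy_def flip: diff_divide_distrib)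
  qed
  ultimately have "1 / (2 * lam) * (\<integral>x. (step_fun n u x - us x)\<^sup>2 \<partial>unit_measure)
      \<le> 1 / (2 * lam) * ?P + 1 / (2 * p) * (\<integral>z. (?kn z - k z) * \<bar>us (snd z) - us (fst z)\<bar> powr p
          \<partial>(unit_measure \<Otimes>\<^sub>M unit_measure))"
    by linarith
  \<comment> \<open>The factor lam / p is 2 * lam times 1 / (2 * p).\<close>
  from mult_left_mono[OF this, of "2 * lam"] show ?thesis
    using lam p by (simp add: distrib_left)
qed

section \<open>Convergence without a rate\<close>

lemma tendsto_truncation_error:
  fixes f :: "'a \<Rightarrow> real"
  assumes f: "integrable M f" and nn: "\<And>x. 0 \<le> f x"
  shows "(\<lambda>m. \<integral>x. f x - min (f x) (real m) \<partial>M) \<longlonglongrightarrow> 0"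
proof -
  have [measurable]: "f \<in> borel_measurable M"
    using f by auto
  have "(\<lambda>m. \<integral>x. f x - min (f x) (real m) \<partial>M) \<longlonglongrightarrow> (\<integral>x. 0 \<partial>M)"
  proof (rule integral_dominated_convergence[where w=f])
    show "AE x in M. (\<lambda>m. f x - min (f x) (real m)) \<longlonglongrightarrow> 0"
    proof (rule AE_I2)
      fix x
      obtain m0 :: nat where "f x \<le> real m0"
        using real_arch_simple by blast
      then have "\<forall>\<^sub>F m in sequentially. f x - min (f x) (real m) = 0"
        by (intro eventually_sequentiallyI[of m0]) auto
      then show "(\<lambda>m. f x - min (f x) (real m)) \<longlonglongrightarrow> 0"
        by (rule tendsto_eventually)
    qed
    show "AE x in M. norm (f x - min (f x) (real m)) \<le> f x" for m
      using nn by (auto simp: min_def)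
  qed (use f in auto)
  then show ?thesis by simp
qed

text \<open>The function \<open>f\<close> may be unbounded, so it is cut at height m: the part below
  m contributes at most m times the integral of \<open>h n\<close>, and the part above at most its
  own integral, since h n \<le> 1. Fixing m before n makes both small without any pointwise
  convergence of \<open>h n\<close>.\<close>

lemma integral_mult_tendsto_0:
  fixes f :: "'a \<Rightarrow> real" and h :: "nat \<Rightarrow> 'a \<Rightarrow> real"
  assumes f: "integrable M f" "\<And>x. 0 \<le> f x"
    and h: "\<And>n. n \<ge> 1 \<Longrightarrow> integrable M (h n)" "\<And>n. n \<ge> 1 \<Longrightarrow> AE x in M. 0 \<le> h n x \<and> h n x \<le> 1"
    and lim: "(\<lambda>n. \<integral>x. h n x \<partial>M) \<longlonglongrightarrow> 0"
  shows "(\<lambda>n. \<integral>x. h n x * f x \<partial>M) \<longlonglongrightarrow> 0"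
proof (rule LIMSEQ_I)
  fix r :: real assume r: "r > 0"
  have [measurable]: "f \<in> borel_measurable M"
    using f by auto
  have "\<forall>\<^sub>F m in sequentially. (\<integral>x. f x - min (f x) (real m) \<partial>M) < r / 2"
    using order_tendstoD(2)[OF tendsto_truncation_error[OF f], of "r / 2"] r by simp
  then obtain m where m: "(\<integral>x. f x - min (f x) (real m) \<partial>M) < r / 2"
    by (auto simp: eventually_sequentially)
  have "(\<lambda>n. real m * (\<integral>x. h n x \<partial>M)) \<longlonglongrightarrow> 0"
    using tendsto_mult_right_zero[OF lim] by simp
  from order_tendstoD(2)[OF this, of "r / 2"] r
  obtain N where N: "\<And>n. n \<ge> N \<Longrightarrow> real m * (\<integral>x. h n x \<partial>M) < r / 2"
    by (auto simp: eventually_sequentially)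
  show "\<exists>N. \<forall>n\<ge>N. norm ((\<integral>x. h n x * f x \<partial>M) - 0) < r"
  proof (intro exI allI impI)
    fix n assume n: "n \<ge> max N 1"
    have hn: "integrable M (h n)" "AE x in M. 0 \<le> h n x \<and> h n x \<le> 1"
      using h[of n] n by auto
    have [measurable]: "h n \<in> borel_measurable M"
      using hn by auto
    have int2: "integrable M (\<lambda>x. f x - min (f x) (real m))"
      by (rule Bochner_Integration.integrable_bound[OF f(1)]) (use f(2) in \<open>auto simp: min_def\<close>)
    have int1: "integrable M (\<lambda>x. h n x * f x)"
    proof (rule Bochner_Integration.integrable_bound[OF f(1)])
      show "AE x in M. norm (h n x * f x) \<le> norm (f x)"
        using hn(2) by eventually_elim (use f(2) in \<open>simp add: abs_mult mult_left_le_one_le\<close>)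
    qed measurable
    have "(\<integral>x. h n x * f x \<partial>M) \<le> (\<integral>x. real m * h n x + (f x - min (f x) (real m)) \<partial>M)"
    proof (rule integral_mono_AE)
      show "integrable M (\<lambda>x. real m * h n x + (f x - min (f x) (real m)))"
        using hn(1) int2 by auto
      show "AE x in M. h n x * f x \<le> real m * h n x + (f x - min (f x) (real m))"
        using hn(2)
      proof eventually_elim
        case (elim x)
        have "h n x * f x = h n x * min (f x) (real m) + h n x * (f x - min (f x) (real m))"
          by (simp add: algebra_simps)
        also have "\<dots> \<le> h n x * real m + 1 * (f x - min (f x) (real m))"
          using elim by (intro add_mono mult_left_mono mult_right_mono) auto
        finally show ?case by (simp add: mult.commute)
      qed
    qed fact
    also have "\<dots> = real m * (\<integral>x. h n x \<partial>M) + (\<integral>x. f x - min (f x) (real m) \<partial>M)"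
      using hn(1) int2 by simp
    also have "\<dots> < r"
      using N[of n] n m by simp
    finally have "(\<integral>x. h n x * f x \<partial>M) < r" .
    moreover have "0 \<le> (\<integral>x. h n x * f x \<partial>M)"
      using hn(2) f(2) by (intro integral_nonneg_AE) (auto elim!: eventually_mono)
    ultimately show "norm ((\<integral>x. h n x * f x \<partial>M) - 0) < r"
      by simp
  qed
qed

text \<open>Measurability supplies continuous functions converging to \<open>f\<close> off a
  negligible set, but with no dominating function. Clipping \<open>f\<close> and the approximants at
  one level B repairs this: differences are then bounded by 2 * B, and the clipping of
  \<open>f\<close> itself costs little.\<close>

lemma continuous_dense_sq_integrable:
  fixes M :: "real measure"
  assumes fin: "finite_measure M" and M: "sets M = sets borel" "absolutely_continuous lborel M"
    and f: "f \<in> sq_integrable M" and r: "r > 0"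
  obtains h where "continuous_on UNIV h" "h \<in> sq_integrable M" "(\<integral>x. (f x - h x)\<^sup>2 \<partial>M) < r"
proof -
  interpret finite_measure M by (rule fin)
  have mM: "borel_measurable M = borel_measurable borel"
    by (rule measurable_cong_sets) (use M in auto)
  have fm [measurable]: "f \<in> borel_measurable borel"
    using f by (auto simp: sq_integrable_def mM)
  define c where "c = (\<lambda>B a::real. max (- B) (min a B))"
  have cB: "\<bar>c B a\<bar> \<le> B" if "B \<ge> 0" for a B
    using that by (auto simp: c_def)
  have ccont: "continuous_on UNIV (c B)" for B
    unfolding c_def by (intro continuous_intros)
  have cm [measurable]: "c B \<in> borel_measurable borel" for B
    by (intro borel_measurable_continuous_onI ccont)
  have csq: "(\<lambda>x. c B (w x)) \<in> sq_integrable M" if "w \<in> borel_measurable borel" "B \<ge> 0" for w B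
    using that cB by (intro sq_integrable_bounded[of _ B]) (auto simp: mM)
  have "(\<lambda>m. \<integral>x. (f x - c (real m) (f x))\<^sup>2 \<partial>M) \<longlonglongrightarrow> (\<integral>x. 0 \<partial>M)"
  proof (rule integral_dominated_convergence[where w="\<lambda>x. (f x)\<^sup>2"])
    show "AE x in M. (\<lambda>m. (f x - c (real m) (f x))\<^sup>2) \<longlonglongrightarrow> 0"
    proof (rule AE_I2)
      fix x
      obtain m0 :: nat where "\<bar>f x\<bar> \<le> real m0"
        using real_arch_simple by blast
      then have "\<forall>\<^sub>F m in sequentially. (f x - c (real m) (f x))\<^sup>2 = 0"
        by (intro eventually_sequentiallyI[of m0]) (auto simp: c_def)
      then show "(\<lambda>m. (f x - c (real m) (f x))\<^sup>2) \<longlonglongrightarrow> 0"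
        by (rule tendsto_eventually)
    qed
    have "\<bar>a - c (real m) a\<bar> \<le> \<bar>a\<bar>" for a m
      by (auto simp: c_def max_def min_def)
    then show "AE x in M. norm ((f x - c (real m) (f x))\<^sup>2) \<le> (f x)\<^sup>2" for m
      by (simp add: abs_le_square_iff)
  qed (use sq_integrable_square[OF f] in \<open>auto simp: mM\<close>)
  \<comment> \<open>Both errors are doubled by (a - b)^2 \<le> 2 (a - d)^2 + 2 (d - b)^2, whence r /
    4 for each.\<close>
  from order_tendstoD(2)[OF this, of "r / 4"] r
  obtain m where m: "(\<integral>x. (f x - c (real m) (f x))\<^sup>2 \<partial>M) < r / 4"
    by (auto simp: eventually_sequentially)
  define B where "B = real m"
  have "f \<in> borel_measurable (lebesgue_on UNIV)"
    using fm by (simp add: lebesgue_on_UNIV_eq measurable_completion)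
  then have "f measurable_on UNIV"
    by (simp add: measurable_on_iff_borel_measurable)
  then obtain N h where N: "negligible N" and h: "\<And>k. continuous_on UNIV (h k)"
      and conv: "\<And>x. x \<notin> N \<Longrightarrow> (\<lambda>k. h k x) \<longlonglongrightarrow> f x"
    unfolding measurable_on_def by auto
  have hm [measurable]: "h k \<in> borel_measurable borel" for k
    by (intro borel_measurable_continuous_onI h)
  have "AE x in lborel. x \<notin> N"
    using AE_not_in[of N lebesgue] N unfolding negligible_iff_null_sets AE_completion_iff by simp
  then have aeN: "AE x in M. x \<notin> N"
    by (rule absolutely_continuous_AE[rotated 2]) (use M in auto)
  have "(\<lambda>k. \<integral>x. (c B (f x) - c B (h k x))\<^sup>2 \<partial>M) \<longlonglongrightarrow> (\<integral>x. 0 \<partial>M)"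
  proof (rule integral_dominated_convergence[where w="\<lambda>x. (2 * B)\<^sup>2"])
    show "AE x in M. (\<lambda>k. (c B (f x) - c B (h k x))\<^sup>2) \<longlonglongrightarrow> 0"
      using aeN
    proof eventually_elim
      case (elim x)
      have "(\<lambda>k. c B (h k x)) \<longlonglongrightarrow> c B (f x)"
        using ccont[of B] conv[OF elim] by (intro continuous_on_tendsto_compose[OF ccont]) auto
      then have "(\<lambda>k. (c B (f x) - c B (h k x))\<^sup>2) \<longlonglongrightarrow> (c B (f x) - c B (f x))\<^sup>2"
        by (intro tendsto_intros)
      then show ?case by simp
    qed
    have "\<bar>c B a - c B b\<bar> \<le> \<bar>2 * B\<bar>" for a b
      using cB[of B a] cB[of B b] by (auto simp: B_def)
    then show "AE x in M. norm ((c B (f x) - c B (h k x))\<^sup>2) \<le> (2 * B)\<^sup>2" for k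
      by (simp add: abs_le_square_iff)
  qed (auto simp: mM)
  from order_tendstoD(2)[OF this, of "r / 4"] r
  obtain k where k: "(\<integral>x. (c B (f x) - c B (h k x))\<^sup>2 \<partial>M) < r / 4"
    by (auto simp: eventually_sequentially)
  let ?h = "\<lambda>x. c B (h k x)"
  show ?thesis
  proof
    show "continuous_on UNIV ?h"
      by (rule continuous_on_compose2[OF ccont h]) auto
    show hsq: "?h \<in> sq_integrable M"
      by (rule csq) (auto simp: B_def)
    have fsq: "(\<lambda>x. c B (f x)) \<in> sq_integrable M"
      by (rule csq) (auto simp: B_def)
    note ints = sq_integrable_square[OF sq_integrable_diff[OF f fsq]] sq_integrable_square[OF sq_integrable_diff[OF fsq hsq]]
    have "(\<integral>x. (f x - ?h x)\<^sup>2 \<partial>M) \<le> (\<integral>x. 2 * (f x - c B (f x))\<^sup>2 + 2 * (c B (f x) - ?h x)\<^sup>2 \<partial>M)"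
    proof (rule integral_mono)
      have "(a - b)\<^sup>2 \<le> 2 * (a - d)\<^sup>2 + 2 * (d - b)\<^sup>2" for a b d :: real
        using sum_squares_bound[of "a - d" "d - b"] power2_sum[of "a - d" "d - b"] by simp
      then show "(f x - ?h x)\<^sup>2 \<le> 2 * (f x - c B (f x))\<^sup>2 + 2 * (c B (f x) - ?h x)\<^sup>2" for x .
    qed (use ints sq_integrable_square[OF sq_integrable_diff[OF f hsq]] in auto)
    also have "\<dots> = 2 * (\<integral>x. (f x - c B (f x))\<^sup>2 \<partial>M) + 2 * (\<integral>x. (c B (f x) - ?h x)\<^sup>2 \<partial>M)"
      using ints by simp
    also have "\<dots> < r"
      using m k by (simp add: B_def)
    finally show "(\<integral>x. (f x - ?h x)\<^sup>2 \<partial>M) < r" .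
  qed
qed

text \<open>As cell averages are the best step approximation, any other step function may be tested.
  The one chosen samples a nearby continuous function at the left ends of the cells, where uniform
  continuity applies.\<close>

lemma cell_avg_step_fun_converges:
  assumes f: "f \<in> sq_integrable unit_measure"
  shows "(\<lambda>n. \<integral>x. (step_fun n (cell_avg f n) x - f x)\<^sup>2 \<partial>unit_measure) \<longlonglongrightarrow> 0"
proof (rule LIMSEQ_I)
  fix r :: real assume r: "r > 0"
  have ac: "absolutely_continuous lborel unit_measure"
    unfolding uniform_on_def by (rule absolutely_continuousI_density) auto
  obtain h where h: "continuous_on UNIV h" "h \<in> sq_integrable unit_measure"
      "(\<integral>x. (f x - h x)\<^sup>2 \<partial>unit_measure) < r / 4"
    using continuous_dense_sq_integrable[OF unit.finite_measure_axioms _ ac f, of "r / 4"] r by auto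
  \<comment> \<open>With this choice 2 * d^2 = r / 2, and the approximation by \<open>h\<close>
    contributes strictly less than the other r / 2.\<close>
  define d where "d = sqrt (r / 4)"
  have d: "d > 0" "d\<^sup>2 = r / 4"
    using r by (auto simp: d_def)
  have "uniformly_continuous_on Omega h"
    by (intro compact_uniformly_continuous continuous_on_subset[OF h(1)]) auto
  then obtain e where e: "e > 0" "\<And>x y. x \<in> Omega \<Longrightarrow> y \<in> Omega \<Longrightarrow> dist y x < e \<Longrightarrow> dist (h y) (h x) < d"
    using d(1) unfolding uniformly_continuous_on_def by metis
  obtain N :: nat where N: "N \<noteq> 0" "inverse (real N) < e"
    using e(1) real_arch_inverse by blast
  show "\<exists>N. \<forall>n\<ge>N. norm ((\<integral>x. (step_fun n (cell_avg f n) x - f x)\<^sup>2 \<partial>unit_measure) - 0) < r"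
  proof (intro exI allI impI)
    fix n assume nN: "n \<ge> N"
    then have n: "n \<ge> 1" and ne: "1 / real n < e"
      using N le_less_trans[of "1 / real n" "inverse (real N)" e] by (auto simp: field_simps)
    let ?w = "step_fun n (\<lambda>i. h ((real i - 1) / real n))"
    have close: "\<bar>?w x - h x\<bar> \<le> d" if x: "0 \<le> x" "x < 1" for x
    proof -
      obtain i where i: "i \<in> {1..n}" "x \<in> cell n i"
        using cell_exists[OF n x] .
      have "(real i - 1) / real n \<le> x" "x < (real i - 1) / real n + 1 / real n"
        using i(2) by (auto simp: cell_def simp flip: add_divide_distrib)
      moreover have "0 \<le> (real i - 1) / real n"
        using i(1) by auto
      ultimately have "dist (h ((real i - 1) / real n)) (h x) < d"
        using x ne by (intro e(2)) (auto simp: dist_real_def)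
      then show ?thesis
        unfolding step_fun_cell[OF n i] by (simp add: dist_real_def)
    qed
    have wsq: "?w \<in> sq_integrable unit_measure"
      by (rule sq_integrable_step_fun)
    note ints = sq_integrable_square[OF sq_integrable_diff[OF f h(2)]]
      sq_integrable_square[OF sq_integrable_diff[OF wsq h(2)]]
      sq_integrable_square[OF sq_integrable_diff[OF wsq f]]
    have "(\<integral>x. (?w x - f x)\<^sup>2 \<partial>unit_measure) \<le> (\<integral>x. 2 * d\<^sup>2 + 2 * (f x - h x)\<^sup>2 \<partial>unit_measure)"
    proof (rule integral_mono_AE)
      show "AE x in unit_measure. (?w x - f x)\<^sup>2 \<le> 2 * d\<^sup>2 + 2 * (f x - h x)\<^sup>2"
        using AE_unit_measure_lt_1
      proof eventually_elim
        case (elim x)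
        have "(?w x - f x)\<^sup>2 \<le> 2 * (?w x - h x)\<^sup>2 + 2 * (f x - h x)\<^sup>2"
          using sum_squares_bound[of "?w x - h x" "h x - f x"] power2_sum[of "?w x - h x" "h x - f x"]
          unfolding power2_commute[of "f x"] by simp
        moreover have "(?w x - h x)\<^sup>2 \<le> d\<^sup>2"
          using close[of x] elim d(1) by (simp add: abs_le_square_iff[symmetric])
        ultimately show ?case by simp
      qed
    qed (use ints in auto)
    also have "\<dots> = 2 * d\<^sup>2 + 2 * (\<integral>x. (f x - h x)\<^sup>2 \<partial>unit_measure)"
      using ints unit.prob_space by simp
    also have "\<dots> < r"
      using h(3) d by simp
    finally have "(\<integral>x. (?w x - f x)\<^sup>2 \<partial>unit_measure) < r" .
    moreover have "(\<integral>x. (step_fun n (cell_avg f n) x - f x)\<^sup>2 \<partial>unit_measure) \<le> (\<integral>x. (?w x - f x)\<^sup>2 \<partial>unit_measure)"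
      unfolding step_fun_pythagoras[OF n f, of "\<lambda>i. h ((real i - 1) / real n)"]
      by (simp add: sum_nonneg)
    ultimately show "norm ((\<integral>x. (step_fun n (cell_avg f n) x - f x)\<^sup>2 \<partial>unit_measure) - 0) < r"
      by simp
  qed
qed

section \<open>Approximation of Lipschitz functions by cell averages\<close>

text \<open>Jensen on the cell of x for y \<mapsto> f y - f x with x fixed, whose average is the
  deviation; n is the reciprocal of the length of the cell.\<close>

lemma cell_avg_deviation:
  assumes n: "n \<ge> 1" "i \<in> {1..n}" and q: "1 \<le> q" "q \<le> 2" and f: "f \<in> sq_integrable unit_measure"
    and x: "x \<in> cell n i"
  shows "\<bar>step_fun n (cell_avg f n) x - f x\<bar> powr q
    \<le> real n * (\<integral>y. indicator (cell n i) y * \<bar>f y - f x\<bar> powr q \<partial>unit_measure)"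
proof -
  have [measurable]: "f \<in> borel_measurable borel"
    using f by (auto simp: sq_integrable_def)
  have fint: "integrable unit_measure f"
    by (rule unit.sq_integrable_integrable[OF f])
  have int: "integrable unit_measure (\<lambda>y. \<bar>f y - f x\<bar> powr q)"
  proof (rule Bochner_Integration.integrable_bound)
    show "integrable unit_measure (\<lambda>y. 1 + 2 * (f y)\<^sup>2 + 2 * (f x)\<^sup>2)"
      using sq_integrable_square[OF f] by simp
    show "AE y in unit_measure. norm (\<bar>f y - f x\<bar> powr q) \<le> norm (1 + 2 * (f y)\<^sup>2 + 2 * (f x)\<^sup>2)"
    proof (rule AE_I2)
      fix y
      show "norm (\<bar>f y - f x\<bar> powr q) \<le> norm (1 + 2 * (f y)\<^sup>2 + 2 * (f x)\<^sup>2)"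
        using abs_diff_powr_le[OF q, of "f y" "f x"] by simp
    qed
  qed simp
  have ifint: "integrable unit_measure (\<lambda>y. indicator (cell n i) y * f y)"
    using fint by (intro integrable_indicator_mult) auto
  have icint: "integrable unit_measure (\<lambda>y. indicator (cell n i) y * f x)"
    by (intro integrable_indicator_mult) auto
  have "(\<integral>y. indicator (cell n i) y * (f y - f x) \<partial>unit_measure)
      = (\<integral>y. indicator (cell n i) y * f y \<partial>unit_measure) - f x / real n"
    using ifint icint integral_cell_const[OF n, of "f x"]
    unfolding right_diff_distrib by (subst Bochner_Integration.integral_diff) auto
  moreover have "cell_avg f n i = real n * (\<integral>y. indicator (cell n i) y * f y \<partial>unit_measure)"
    by (rule cell_avg_eq[OF n]) auto
  ultimately have avg: "(\<integral>y. indicator (cell n i) y * (f y - f x) \<partial>unit_measure)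
      = (cell_avg f n i - f x) / real n"
    using n by (simp add: field_simps)
  have "measure unit_measure (cell n i) *
      \<bar>(\<integral>y. indicator (cell n i) y * (f y - f x) \<partial>unit_measure) / measure unit_measure (cell n i)\<bar> powr q
      \<le> (\<integral>y. indicator (cell n i) y * \<bar>f y - f x\<bar> powr q \<partial>unit_measure)"
    using n(1) measure_cell[OF n]
    by (intro unit.jensen_on_set convex_on_abs_powr q int Bochner_Integration.integrable_diff fint) auto
  then have "1 / real n * \<bar>cell_avg f n i - f x\<bar> powr q
      \<le> (\<integral>y. indicator (cell n i) y * \<bar>f y - f x\<bar> powr q \<partial>unit_measure)"
    unfolding avg measure_cell[OF n] using n(1) by simp
  then show ?thesis
    unfolding step_fun_cell[OF n x] using n(1) by (simp add: field_simps)
qed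

lemma near_diagonal_measurable:
  "{(x, y). x \<in> Omega \<and> y \<in> Omega \<and> \<bar>y - x\<bar> < \<delta>} \<in> sets (borel \<Otimes>\<^sub>M borel)"
proof -
  have "Measurable.pred (borel \<Otimes>\<^sub>M borel) (\<lambda>z. fst z \<in> Omega \<and> snd z \<in> Omega \<and> \<bar>snd z - fst z\<bar> < \<delta>)"
    by measurable
  then show ?thesis
    by (simp add: pred_def space_pair_measure case_prod_beta')
qed

text \<open>The substitution y = x + z turns the strip around the diagonal into shifts. After
  Tonelli the inner integral is the one bounded by W, and z ranges over an interval of length 2 *
  \<delta>.\<close>

lemma nn_integral_near_diagonal_le:
  fixes f :: "real \<Rightarrow> real" and W \<delta> q :: real
  assumes f [measurable]: "f \<in> borel_measurable borel" and \<delta>: "\<delta> \<ge> 0"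
    and W: "\<And>z. \<bar>z\<bar> < \<delta> \<Longrightarrow>
      (\<integral>\<^sup>+x. indicator {x. x \<in> Omega \<and> x + z \<in> Omega} x * ennreal (\<bar>f (x + z) - f x\<bar> powr q) \<partial>lborel) \<le> ennreal W"
  shows "(\<integral>\<^sup>+x. \<integral>\<^sup>+y. indicator {(x, y). x \<in> Omega \<and> y \<in> Omega \<and> \<bar>y - x\<bar> < \<delta>} (x, y)
            * ennreal (\<bar>f y - f x\<bar> powr q) \<partial>lborel \<partial>lborel) \<le> ennreal (2 * \<delta>) * ennreal W"
proof -
  define S where "S = {(x, y). x \<in> Omega \<and> y \<in> Omega \<and> \<bar>y - x\<bar> < \<delta>}"
  define F where "F z = indicator S z * ennreal (\<bar>f (snd z) - f (fst z)\<bar> powr q)" for z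
  have S [measurable]: "S \<in> sets (borel \<Otimes>\<^sub>M borel)"
    unfolding S_def by (rule near_diagonal_measurable)
  have Fm [measurable]: "F \<in> borel_measurable (borel \<Otimes>\<^sub>M borel)"
    unfolding F_def by measurable
  have "(\<integral>\<^sup>+x. \<integral>\<^sup>+y. F (x, y) \<partial>lborel \<partial>lborel) = (\<integral>\<^sup>+x. \<integral>\<^sup>+z. F (x, x + z) \<partial>lborel \<partial>lborel)"
  proof (rule nn_integral_cong)
    fix x :: real
    have "(\<lambda>y. F (x, y)) \<in> borel_measurable borel"
      by measurable
    from nn_integral_real_affine[OF this, of 1 x]
    show "(\<integral>\<^sup>+y. F (x, y) \<partial>lborel) = (\<integral>\<^sup>+z. F (x, x + z) \<partial>lborel)"
      by simp
  qed
  also have "\<dots> = (\<integral>\<^sup>+z. \<integral>\<^sup>+x. F (x, x + z) \<partial>lborel \<partial>lborel)"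
    by (rule lborel_pair.Fubini'[symmetric]) measurable
  also have "\<dots> \<le> (\<integral>\<^sup>+z. ennreal W * indicator {- \<delta><..<\<delta>} z \<partial>lborel)"
  proof (rule nn_integral_mono)
    fix z :: real
    show "(\<integral>\<^sup>+x. F (x, x + z) \<partial>lborel) \<le> ennreal W * indicator {- \<delta><..<\<delta>} z"
    proof (cases "\<bar>z\<bar> < \<delta>")
      case True
      have "(\<integral>\<^sup>+x. F (x, x + z) \<partial>lborel)
          \<le> (\<integral>\<^sup>+x. indicator {x. x \<in> Omega \<and> x + z \<in> Omega} x * ennreal (\<bar>f (x + z) - f x\<bar> powr q) \<partial>lborel)"
        by (intro nn_integral_mono) (auto simp: indicator_def F_def S_def)
      with W[OF True] True show ?thesis
        by (auto simp: indicator_def abs_less_iff intro: order_trans)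
    next
      case False
      then have "F (x, x + z) = 0" for x
        by (auto simp: indicator_def F_def S_def)
      then show ?thesis by simp
    qed
  qed
  also have "\<dots> = ennreal (2 * \<delta>) * ennreal W"
    using \<delta> by (simp add: nn_integral_cmult mult.commute)
  finally show ?thesis
    by (simp add: F_def S_def)
qed

lemma nn_integral_uniform_on:
  assumes [measurable]: "A \<in> sets borel" "f \<in> borel_measurable borel"
  shows "(\<integral>\<^sup>+x. f x \<partial>uniform_on A) = (\<integral>\<^sup>+x. indicator A x * f x \<partial>lborel)"
  unfolding uniform_on_def by (subst nn_integral_density) auto

text \<open>The deviation at x is an average over its cell, and enlarging the diagonal squares to
  the strip of half-width 1 / n gives a quantity governed by shifts. The factor n of the average
  cancels against the width 2 / n of the strip, leaving 2.\<close>

lemma cell_avg_powr_error_le: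
  assumes n: "n \<ge> 1" and q: "1 \<le> q" "q \<le> 2" and f: "f \<in> sq_integrable unit_measure"
    and W: "\<And>z. \<bar>z\<bar> < 1 / real n \<Longrightarrow>
      (\<integral>\<^sup>+x. indicator {x. x \<in> Omega \<and> x + z \<in> Omega} x * ennreal (\<bar>f (x + z) - f x\<bar> powr q) \<partial>lborel) \<le> ennreal W"
  shows "(\<integral>\<^sup>+x. ennreal (\<bar>step_fun n (cell_avg f n) x - f x\<bar> powr q) \<partial>unit_measure) \<le> ennreal 2 * ennreal W"
proof -
  have fb [measurable]: "f \<in> borel_measurable borel"
    using f by (auto simp: sq_integrable_def)
  define S where "S = {(x, y). x \<in> Omega \<and> y \<in> Omega \<and> \<bar>y - x\<bar> < 1 / real n}"
  define F where "F z = indicator S z * ennreal (\<bar>f (snd z) - f (fst z)\<bar> powr q)" for z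
  have S [measurable]: "S \<in> sets (borel \<Otimes>\<^sub>M borel)"
    unfolding S_def by (rule near_diagonal_measurable)
  have Fm [measurable]: "F \<in> borel_measurable (borel \<Otimes>\<^sub>M borel)"
    unfolding F_def by measurable
  have near: "(\<integral>\<^sup>+x. \<integral>\<^sup>+y. F (x, y) \<partial>lborel \<partial>lborel) \<le> ennreal (2 * (1 / real n)) * ennreal W"
    unfolding F_def S_def fst_conv snd_conv by (rule nn_integral_near_diagonal_le[OF fb _ W]) auto
  have pt: "ennreal (\<bar>step_fun n (cell_avg f n) x - f x\<bar> powr q) \<le> ennreal (real n) * (\<integral>\<^sup>+y. F (x, y) \<partial>lborel)"
    if x: "0 \<le> x" "x < 1" for x
  proof -
    obtain i where i: "i \<in> {1..n}" "x \<in> cell n i"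
      using cell_exists[OF n x] .
    let ?h = "\<lambda>y. indicator (cell n i) y * \<bar>f y - f x\<bar> powr q"
    have F_ge: "indicator Omega y * ennreal (?h y) \<le> F (x, y)" for y
    proof (cases "y \<in> cell n i")
      case True
      \<comment> \<open>The strict inequality is due to the half-open cells; the shift bound
        \<open>W\<close> covers only strict ones.\<close>
      then have "\<bar>y - x\<bar> < 1 / real n"
        using i by (auto simp: cell_def abs_less_iff diff_divide_distrib)
      moreover have "x \<in> Omega" "y \<in> Omega"
        using True x cell_subset[OF n i(1)] by auto
      ultimately show ?thesis
        using True by (simp add: indicator_def F_def S_def)
    qed simp
    have "\<bar>step_fun n (cell_avg f n) x - f x\<bar> powr q \<le> real n * (\<integral>y. ?h y \<partial>unit_measure)"
      by (rule cell_avg_deviation[OF n i(1) q f i(2)])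
    then have "ennreal (\<bar>step_fun n (cell_avg f n) x - f x\<bar> powr q)
        \<le> ennreal (real n) * ennreal (\<integral>y. ?h y \<partial>unit_measure)"
      by (simp add: ennreal_leI flip: ennreal_mult')
    moreover have "ennreal (\<integral>y. ?h y \<partial>unit_measure) \<le> (\<integral>\<^sup>+y. F (x, y) \<partial>lborel)"
    proof -
      \<comment> \<open>Since \<open>enn2real a\<close> never exceeds \<open>a\<close>, the Bochner
        integral is bounded by the nonnegative one without checking integrability.\<close>
      have "(\<integral>y. ?h y \<partial>unit_measure) = enn2real (\<integral>\<^sup>+y. ennreal (?h y) \<partial>unit_measure)"
        by (rule integral_eq_nn_integral) auto
      moreover have "ennreal (enn2real a) \<le> a" for a
        by (cases a) auto
      ultimately have "ennreal (\<integral>y. ?h y \<partial>unit_measure) \<le> (\<integral>\<^sup>+y. ennreal (?h y) \<partial>unit_measure)"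
        by simp
      also have "\<dots> = (\<integral>\<^sup>+y. indicator Omega y * ennreal (?h y) \<partial>lborel)"
        by (rule nn_integral_uniform_on) auto
      also have "\<dots> \<le> (\<integral>\<^sup>+y. F (x, y) \<partial>lborel)"
        by (rule nn_integral_mono) (rule F_ge)
      finally show ?thesis .
    qed
    ultimately show ?thesis
      by (meson mult_left_mono order_trans zero_le)
  qed
  have "(\<integral>\<^sup>+x. ennreal (\<bar>step_fun n (cell_avg f n) x - f x\<bar> powr q) \<partial>unit_measure)
      \<le> (\<integral>\<^sup>+x. ennreal (real n) * (\<integral>\<^sup>+y. F (x, y) \<partial>lborel) \<partial>unit_measure)"
    by (rule nn_integral_mono_AE, rule eventually_mono[OF AE_unit_measure_lt_1]) (simp add: pt)
  also have "\<dots> = (\<integral>\<^sup>+x. indicator Omega x * (ennreal (real n) * (\<integral>\<^sup>+y. F (x, y) \<partial>lborel)) \<partial>lborel)"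
    by (rule nn_integral_uniform_on) measurable
  also have "\<dots> \<le> (\<integral>\<^sup>+x. ennreal (real n) * (\<integral>\<^sup>+y. F (x, y) \<partial>lborel) \<partial>lborel)"
    by (rule nn_integral_mono) (simp add: indicator_def)
  also have "\<dots> = ennreal (real n) * (\<integral>\<^sup>+x. \<integral>\<^sup>+y. F (x, y) \<partial>lborel \<partial>lborel)"
    by (rule nn_integral_cmult) measurable
  also have "\<dots> \<le> ennreal (real n) * (ennreal (2 * (1 / real n)) * ennreal W)"
    by (intro mult_left_mono near) auto
  also have "\<dots> = ennreal 2 * ennreal W"
    using n by (simp add: mult.assoc[symmetric] ennreal_mult[symmetric])
  finally show ?thesis .
qed

text \<open>Interpolation between the power q and the supremum: the square of the error is its power
  q times its power 2 - q, and the latter is bounded because the error is at most 2 * B.\<close>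

lemma cell_avg_square_error_le:
  assumes n: "n \<ge> 1" and q: "1 \<le> q" "q \<le> 2" and f: "f \<in> borel_measurable borel"
    and B: "\<And>x. \<bar>f x\<bar> \<le> B" and W0: "W \<ge> 0"
    and W: "\<And>z. \<bar>z\<bar> < 1 / real n \<Longrightarrow>
      (\<integral>\<^sup>+x. indicator {x. x \<in> Omega \<and> x + z \<in> Omega} x * ennreal (\<bar>f (x + z) - f x\<bar> powr q) \<partial>lborel) \<le> ennreal W"
  shows "(\<integral>x. (step_fun n (cell_avg f n) x - f x)\<^sup>2 \<partial>unit_measure) \<le> (2 * B) powr (2 - q) * (2 * W)"
proof -
  note [measurable] = f
  have B0: "B \<ge> 0"
    using B[of 0] by linarith
  have fsq: "f \<in> sq_integrable unit_measure"
    using f B by (intro unit.sq_integrable_bounded) auto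
  let ?d = "\<lambda>x. step_fun n (cell_avg f n) x - f x"
  have dB: "\<bar>?d x\<bar> \<le> 2 * B" if x: "0 \<le> x" "x < 1" for x
  proof -
    obtain i where i: "i \<in> {1..n}" "x \<in> cell n i"
      using cell_exists[OF n x] .
    have "\<bar>\<integral>y. indicator (cell n i) y * f y \<partial>unit_measure\<bar>
        \<le> (\<integral>y. \<bar>indicator (cell n i) y * f y\<bar> \<partial>unit_measure)"
      by (rule integral_abs_bound)
    also have "\<dots> \<le> (\<integral>y. indicator (cell n i) y * B \<partial>unit_measure)"
      using B unit.sq_integrable_integrable[OF fsq] B0
      by (intro integral_mono integrable_abs integrable_indicator_mult)
         (auto simp: abs_mult indicator_def)
    also have "\<dots> = B / real n"
      by (rule integral_cell_const[OF n i(1)])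
    finally have "\<bar>cell_avg f n i\<bar> \<le> B"
      using n cell_avg_eq[OF n i(1) f, of f] by (simp add: abs_mult field_simps)
    then show ?thesis
      unfolding step_fun_cell[OF n i] using B[of x] by linarith
  qed
  have "ennreal (\<integral>x. (?d x)\<^sup>2 \<partial>unit_measure) = (\<integral>\<^sup>+x. ennreal ((?d x)\<^sup>2) \<partial>unit_measure)"
    by (intro nn_integral_eq_integral[symmetric] sq_integrable_square sq_integrable_diff
        sq_integrable_step_fun fsq) auto
  also have "\<dots> \<le> (\<integral>\<^sup>+x. ennreal ((2 * B) powr (2 - q)) * ennreal (\<bar>?d x\<bar> powr q) \<partial>unit_measure)"
  proof (rule nn_integral_mono_AE)
    show "AE x in unit_measure. ennreal ((?d x)\<^sup>2) \<le> ennreal ((2 * B) powr (2 - q)) * ennreal (\<bar>?d x\<bar> powr q)"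
      using AE_unit_measure_lt_1
    proof eventually_elim
      case (elim x)
      have "(?d x)\<^sup>2 \<le> (2 * B) powr (2 - q) * \<bar>?d x\<bar> powr q"
      proof (cases "?d x = 0")
        case False
        then have "(?d x)\<^sup>2 = \<bar>?d x\<bar> powr (2 - q) * \<bar>?d x\<bar> powr q"
          by (simp add: powr_numeral flip: powr_add)
        also have "\<dots> \<le> (2 * B) powr (2 - q) * \<bar>?d x\<bar> powr q"
          using dB[of x] elim q by (intro mult_right_mono powr_mono2) auto
        finally show ?thesis .
      qed simp
      then show ?case
        by (simp add: ennreal_leI flip: ennreal_mult)
    qed
  qed
  also have "\<dots> = ennreal ((2 * B) powr (2 - q)) * (\<integral>\<^sup>+x. ennreal (\<bar>?d x\<bar> powr q) \<partial>unit_measure)"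
    by (rule nn_integral_cmult) auto
  also have "\<dots> \<le> ennreal ((2 * B) powr (2 - q)) * (ennreal 2 * ennreal W)"
    by (intro mult_left_mono cell_avg_powr_error_le n q fsq W) auto
  also have "\<dots> = ennreal ((2 * B) powr (2 - q) * (2 * W))"
    using W0 by (simp add: ennreal_mult)
  finally show ?thesis
    using W0 by (subst (asm) ennreal_le_iff) auto
qed

lemma AE_lborel_translate:
  fixes P :: "real \<Rightarrow> bool"
  assumes "AE x in lborel. P x"
  shows "AE x in lborel. P (x + z)"
proof -
  from assms obtain N where N: "{x \<in> space lborel. \<not> P x} \<subseteq> N" "N \<in> null_sets lborel"
    by (auto simp: eventually_ae_filter)
  then have Nb [measurable]: "N \<in> sets borel"
    by auto
  have "AE x in distr lborel borel ((+) z). x \<notin> N"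
    using AE_not_in[OF N(2)] by (subst lborel_distr_plus)
  then have "AE x in lborel. z + x \<notin> N"
    by (rule AE_distrD[rotated]) simp
  then show ?thesis
    by eventually_elim (use N(1) in \<open>auto simp: add.commute\<close>)
qed

text \<open>A shift is dominated by the modulus only if the real supremum defining it is over a
  bounded set, which the bound on \<open>f\<close> guarantees. Passing from \<open>g\<close> to
  \<open>f\<close> inside a shift uses translation invariance of null sets.\<close>

lemma Lip_space_shift_bound:
  assumes g: "g \<in> Lip_space s q" and q: "q \<ge> 1"
    and f [measurable]: "f \<in> borel_measurable borel" and B: "\<And>x. \<bar>f x\<bar> \<le> B"
    and ae: "AE x in unit_measure. g x = f x"
  obtains L where "L \<ge> 0" "\<And>h z. h > 0 \<Longrightarrow> \<bar>z\<bar> < h \<Longrightarrow>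
      (\<integral>\<^sup>+x. indicator {x. x \<in> Omega \<and> x + z \<in> Omega} x * ennreal (\<bar>f (x + z) - f x\<bar> powr q) \<partial>lborel)
      \<le> ennreal (L * h powr (s * q))"
proof -
  define A where "A z = {x::real. x \<in> Omega \<and> x + z \<in> Omega}" for z
  define I where "I z = (\<integral>x. \<bar>f (x + z) - f x\<bar> powr q \<partial>uniform_on (A z))" for z
  have A_eq: "A z = Omega \<inter> {- z..1 - z}" for z
    by (auto simp: A_def)
  have Ab [measurable]: "A z \<in> sets borel" for z
    unfolding A_eq by simp
  have A1: "emeasure lborel (A z) \<le> 1" for z
    using emeasure_mono[of "A z" Omega lborel] by (simp add: A_eq)
  have fin: "finite_measure (uniform_on (A z))" for z
    using A1[of z] by (intro finite_measure_uniform_on) (auto simp: top_unique)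
  have bound: "\<bar>f (x + z) - f x\<bar> powr q \<le> (2 * B) powr q" for x z
    using B[of x] B[of "x + z"] q by (intro powr_mono2) auto
  have I_leb: "integral\<^sup>L (lebesgue_on (A z)) (\<lambda>x. \<bar>g (x + z) - g x\<bar> powr q) = I z" for z
    unfolding I_def
  proof (rule lebesgue_on_eq_uniform_on)
    have "AE x in lborel. x \<in> Omega \<longrightarrow> g x = f x"
      using ae by (simp add: AE_uniform_on)
    with AE_lborel_translate[OF this, of z]
    show "AE x in uniform_on (A z). \<bar>g (x + z) - g x\<bar> powr q = \<bar>f (x + z) - f x\<bar> powr q"
      unfolding AE_uniform_on[OF Ab] by eventually_elim (auto simp: A_def)
  qed auto
  have I_nonneg: "I z \<ge> 0" for z
    unfolding I_def by simp
  have I_int: "integrable (uniform_on (A z)) (\<lambda>x. \<bar>f (x + z) - f x\<bar> powr q)" for z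
    using bound by (intro finite_measure.integrable_const_bound[OF fin, where B="(2 * B) powr q"]) auto
  have I_le: "I z \<le> (2 * B) powr q" for z
  proof -
    interpret finite_measure "uniform_on (A z)" by (rule fin)
    have "I z \<le> (\<integral>x. (2 * B) powr q \<partial>uniform_on (A z))"
      unfolding I_def by (intro integral_mono I_int bound) auto
    also have "\<dots> = measure (uniform_on (A z)) UNIV * (2 * B) powr q"
      by simp
    also have "measure (uniform_on (A z)) UNIV \<le> 1"
      using A1[of z] by (simp add: measure_def emeasure_uniform_on enn2real_leI)
    finally show ?thesis
      by (simp add: mult_right_mono)
  qed
  have le_mod: "I z powr (1 / q) \<le> modulus q g h" if "\<bar>z\<bar> < h" for z h
    unfolding modulus_def I_leb[unfolded A_def]
  proof (rule cSUP_upper)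
    show "bdd_above ((\<lambda>z. I z powr (1 / q)) ` {z. \<bar>z\<bar> < h})"
      using q by (intro bdd_aboveI2[of _ _ "((2 * B) powr q) powr (1 / q)"] powr_mono2 I_le I_nonneg) auto
  qed (use that in simp)
  from g obtain L0 where L0: "\<And>h. h > 0 \<Longrightarrow> h powr (- s) * modulus q g h \<le> L0"
    unfolding Lip_space_def bdd_above_def by auto
  \<comment> \<open>The modulus carries the power 1 / q; raising to the power q produces the
    exponent s * q. The \<open>max\<close> keeps the base of \<open>powr\<close>
    nonnegative.\<close>
  have I_Lip: "I z \<le> max L0 0 powr q * h powr (s * q)" if h: "h > 0" "\<bar>z\<bar> < h" for h z
  proof -
    have "h powr (- s) * I z powr (1 / q) \<le> h powr (- s) * modulus q g h"
      by (intro mult_left_mono le_mod h) auto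
    also have "\<dots> \<le> max L0 0"
      using L0[OF h(1)] by simp
    finally have "h powr s * (h powr (- s) * I z powr (1 / q)) \<le> h powr s * max L0 0"
      by (intro mult_left_mono) auto
    then have "I z powr (1 / q) \<le> h powr s * max L0 0"
      using h(1) by (simp add: powr_minus mult.assoc[symmetric])
    then have "(I z powr (1 / q)) powr q \<le> (h powr s * max L0 0) powr q"
      using q by (intro powr_mono2) auto
    then show ?thesis
      using q I_nonneg[of z] by (simp add: powr_powr powr_mult mult.commute)
  qed
  show ?thesis
  proof (rule that[of "max L0 0 powr q"])
    fix h z :: real assume h: "h > 0" "\<bar>z\<bar> < h"
    have "(\<integral>\<^sup>+x. indicator (A z) x * ennreal (\<bar>f (x + z) - f x\<bar> powr q) \<partial>lborel)
        = (\<integral>\<^sup>+x. ennreal (\<bar>f (x + z) - f x\<bar> powr q) \<partial>uniform_on (A z))"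
      by (rule nn_integral_uniform_on[symmetric]) auto
    also have "\<dots> = ennreal (I z)"
      unfolding I_def by (intro nn_integral_eq_integral I_int) auto
    also have "\<dots> \<le> ennreal (max L0 0 powr q * h powr (s * q))"
      by (intro ennreal_leI I_Lip h)
    finally show "(\<integral>\<^sup>+x. indicator {x. x \<in> Omega \<and> x + z \<in> Omega} x * ennreal (\<bar>f (x + z) - f x\<bar> powr q) \<partial>lborel)
        \<le> ennreal (max L0 0 powr q * h powr (s * q))"
      by (simp add: A_def)
  qed simp
qed

section \<open>Edge densities and box counting\<close>

lemma AE_unit_pairI:
  assumes "AE x in unit_measure. P x"
  shows "AE z in unit_measure \<Otimes>\<^sub>M unit_measure. P (fst z)"
    and "AE z in unit_measure \<Otimes>\<^sub>M unit_measure. P (snd z)"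
proof -
  have "AE x in distr (unit_measure \<Otimes>\<^sub>M unit_measure) unit_measure fst. P x"
    using assms by (subst unit.distr_pair_fst)
  then show 1: "AE z in unit_measure \<Otimes>\<^sub>M unit_measure. P (fst z)"
    by (rule AE_distrD[rotated]) simp
  have "AE z in distr (unit_measure \<Otimes>\<^sub>M unit_measure) (unit_measure \<Otimes>\<^sub>M unit_measure) (\<lambda>(x, y). (y, x)). P (fst z)"
    using 1 by (subst unit_pair.distr_pair_swap[symmetric])
  from AE_distrD[OF _ this]
  show "AE z in unit_measure \<Otimes>\<^sub>M unit_measure. P (snd z)"
    by (simp add: case_prod_beta')
qed

lemma measurable_PiM_edge:
  "(\<lambda>x. (x 0, x 1)) \<in> measurable (PiM {0, 1::nat} (\<lambda>_. restrict_space lborel Omega))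
    (unit_measure \<Otimes>\<^sub>M unit_measure)"
proof -
  let ?R = "restrict_space lborel Omega :: real measure"
  let ?N = "PiM {0, 1::nat} (\<lambda>_. ?R)"
  have "(\<lambda>x. x i) \<in> measurable ?N unit_measure" if "i \<in> {0, 1}" for i
  proof -
    have "(\<lambda>x. x i) \<in> measurable ?N ?R"
      by (rule measurable_component_singleton[OF that])
    from measurable_compose[OF this measurable_restrict_space1[OF measurable_ident]]
    have "(\<lambda>x. x i) \<in> measurable ?N lborel"
      by simp
    then show ?thesis
      by (simp cong: measurable_cong_sets)
  qed
  then show ?thesis
    by (intro measurable_Pair) auto
qed

text \<open>Both measures agree on rectangles, which determines them.\<close>

lemma distr_PiM_edge:
  "distr (PiM {0, 1::nat} (\<lambda>_. restrict_space lborel Omega)) (unit_measure \<Otimes>\<^sub>M unit_measure) (\<lambda>x. (x 0, x 1))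
    = unit_measure \<Otimes>\<^sub>M unit_measure"
proof -
  let ?R = "restrict_space lborel Omega :: real measure"
  let ?N = "PiM {0, 1::nat} (\<lambda>_. ?R)" and ?T = "\<lambda>x::nat \<Rightarrow> real. (x 0, x 1)"
  have "prob_space ?R"
    by (rule prob_space_restrict_space) auto
  then interpret P: product_prob_space "\<lambda>_. ?R" "{0, 1::nat}"
    by (simp add: product_prob_space_def product_sigma_finite_def product_prob_space_axioms_def
        prob_space_imp_sigma_finite)
  note T = measurable_PiM_edge
  show ?thesis
  proof (rule pair_measure_eqI[symmetric])
    fix A B assume A: "A \<in> sets unit_measure" and B: "B \<in> sets unit_measure"
    \<comment> \<open>The factors of the indexed product live on \<open>Omega\<close>, those of the
      binary product on the whole line; hence the intersections.\<close>
    define C where "C i = (if i = (0::nat) then A \<inter> Omega else B \<inter> Omega)" for i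
    have C: "C i \<in> sets ?R" for i
      using A B by (auto simp: C_def sets_restrict_space)
    have emR: "emeasure ?R (D \<inter> Omega) = emeasure unit_measure D" if "D \<in> sets unit_measure" for D
      using that by (simp add: emeasure_restrict_space emeasure_uniform_on Int_commute)
    have "?T -` (A \<times> B) \<inter> space ?N = (\<Pi>\<^sub>E i\<in>{0, 1}. C i)"
      by (auto simp: space_PiM space_restrict_space C_def PiE_def Pi_def extensional_def split: if_splits)
    then have "emeasure (distr ?N (unit_measure \<Otimes>\<^sub>M unit_measure) ?T) (A \<times> B) = emeasure ?N (\<Pi>\<^sub>E i\<in>{0, 1}. C i)"
      using A B by (subst emeasure_distr[OF T]) auto
    also have "\<dots> = (\<Prod>i\<in>{0, 1}. emeasure ?R (C i))"
      by (rule P.emeasure_PiM) (use C in auto)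
    also have "\<dots> = emeasure unit_measure A * emeasure unit_measure B"
      using A B by (simp add: C_def emR)
    finally show "emeasure unit_measure A * emeasure unit_measure B
        = emeasure (distr ?N (unit_measure \<Otimes>\<^sub>M unit_measure) ?T) (A \<times> B)" ..
  qed (auto intro: unit.sigma_finite_measure_axioms)
qed

text \<open>The coordinate map preserves measure, so null sets pull back to null sets and
  \<open>W\<close> may be replaced by \<open>W'\<close> under the completed product. The ordering
  condition i < j keeps one factor for the edge.\<close>

lemma hom_density_edge:
  assumes W': "W' \<in> borel_measurable (unit_measure \<Otimes>\<^sub>M unit_measure)"
    and ae: "AE z in unit_measure \<Otimes>\<^sub>M unit_measure. W z = W' z"
  shows "hom_density {0, 1} {(0, 1), (1, 0)} W = (\<integral>z. W' z \<partial>(unit_measure \<Otimes>\<^sub>M unit_measure))"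
proof -
  let ?N = "PiM {0, 1::nat} (\<lambda>_. restrict_space lborel Omega)" and ?T = "\<lambda>x::nat \<Rightarrow> real. (x 0, x 1)"
  note T = measurable_PiM_edge
  have "{(i, j). (i, j) \<in> {(0, 1), (1, 0)} \<and> i < j} = {(0, 1::nat)}"
    by auto
  then have "hom_density {0, 1} {(0, 1), (1, 0)} W = integral\<^sup>L (completion ?N) (\<lambda>x. W (?T x))"
    by (simp add: hom_density_def)
  also have "\<dots> = integral\<^sup>L (completion ?N) (\<lambda>x. W' (?T x))"
  proof (rule integral_cong_AE)
    have m: "(\<lambda>x. W' (?T x)) \<in> borel_measurable ?N"
      by (rule measurable_compose[OF T W'])
    then show m': "(\<lambda>x. W' (?T x)) \<in> borel_measurable (completion ?N)"
      by (rule measurable_completion)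
    have "AE z in distr ?N (unit_measure \<Otimes>\<^sub>M unit_measure) ?T. W z = W' z"
      using ae by (subst distr_PiM_edge)
    from AE_distrD[OF T this]
    show ae': "AE x in completion ?N. W (?T x) = W' (?T x)"
      by (rule AE_completion)
    show "(\<lambda>x. W (?T x)) \<in> borel_measurable (completion ?N)"
      by (rule completion.borel_measurable_AE_eq[OF m' ae'])
  qed
  also have "\<dots> = integral\<^sup>L ?N (\<lambda>x. W' (?T x))"
    by (rule integral_completion) (rule measurable_compose[OF T W'])
  also have "\<dots> = integral\<^sup>L (distr ?N (unit_measure \<Otimes>\<^sub>M unit_measure) ?T) W'"
    by (rule integral_distr[OF T W', symmetric])
  finally show ?thesis
    unfolding distr_PiM_edge .
qed

section \<open>From the norms and energies of the statement to Borel data\<close>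

lemma L_norm_2_eq:
  assumes "f' \<in> borel_measurable borel" "AE x in unit_measure. f x = f' x"
  shows "(L_norm 2 f)\<^sup>2 = (\<integral>x. (f' x)\<^sup>2 \<partial>unit_measure)" "L_norm 2 f \<ge> 0"
proof -
  have "integral\<^sup>L (lebesgue_on Omega) (\<lambda>x. \<bar>f x\<bar> powr 2) = (\<integral>x. (f' x)\<^sup>2 \<partial>unit_measure)"
    using assms by (intro lebesgue_on_eq_uniform_on) (auto simp: powr_numeral elim!: eventually_mono)
  then show "(L_norm 2 f)\<^sup>2 = (\<integral>x. (f' x)\<^sup>2 \<partial>unit_measure)"
    by (simp add: L_norm_def powr_half_sqrt)
qed (simp add: L_norm_def)

lemma L_space_2_representative:
  assumes f: "f \<in> L_space 2" and f': "f' \<in> borel_measurable borel" "AE x in unit_measure. f x = f' x"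
  shows "f' \<in> sq_integrable unit_measure"
proof -
  have "integrable (lebesgue_on Omega) (\<lambda>x. \<bar>f x\<bar> powr 2) \<longleftrightarrow> integrable unit_measure (\<lambda>x. (f' x)\<^sup>2)"
    using f' by (intro lebesgue_on_eq_uniform_on) (auto simp: powr_numeral elim!: eventually_mono)
  then show ?thesis
    using f f'(1) by (simp add: L_space_def sq_integrable_def)
qed

lemma sq_integrable_in_L_space:
  assumes f: "f \<in> sq_integrable unit_measure"
  shows "f \<in> L_space 2"
proof -
  have f': "f \<in> borel_measurable borel"
    using f by (auto simp: sq_integrable_def)
  have "integrable (lebesgue_on Omega) (\<lambda>x. \<bar>f x\<bar> powr 2) \<longleftrightarrow> integrable unit_measure (\<lambda>x. (f x)\<^sup>2)"
    using f' by (intro lebesgue_on_eq_uniform_on) (auto simp: powr_numeral)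
  moreover have "f \<in> borel_measurable (lebesgue_on Omega)"
    using f' by (intro lebesgue_on_eq_uniform_on[of _ f]) auto
  ultimately show ?thesis
    using f by (simp add: L_space_def sq_integrable_def)
qed

text \<open>Integrability selects the finite branch of \<open>nonlocal_reg\<close>, so the
  minimization becomes one of a real-valued functional.\<close>

lemma energy_eq:
  assumes kp: "kernel_problem unit_measure lam p g' k"
    and g: "AE x in unit_measure. g x = g' x"
    and K: "AE z in unit_measure \<Otimes>\<^sub>M unit_measure. K z = k z"
    and v': "v' \<in> sq_integrable unit_measure" and v: "AE x in unit_measure. v x = v' x"
  shows "energy lam p g K v = ereal (kernel_energy unit_measure lam p g' k v')"
proof -
  interpret kernel_problem unit_measure lam p g' k by fact
  have [measurable]: "g' \<in> borel_measurable borel" "v' \<in> borel_measurable borel"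
    using g v' by (auto simp: sq_integrable_def)
  have "(L_norm 2 (\<lambda>x. v x - g x))\<^sup>2 = (\<integral>x. (v' x - g' x)\<^sup>2 \<partial>unit_measure)"
  proof (rule L_norm_2_eq)
    show "AE x in unit_measure. v x - g x = v' x - g' x"
      using assms(2) v by eventually_elim simp
  qed simp
  moreover have "nonlocal_reg p K v = ereal (1 / (2 * p) * dirichlet unit_measure p k v')"
  proof -
    let ?f = "\<lambda>(x, y). K (x, y) * \<bar>v y - v x\<bar> powr p"
    let ?f' = "\<lambda>z. k z * \<bar>v' (snd z) - v' (fst z)\<bar> powr p"
    have ae: "AE z in uniform_on (Omega \<times> Omega). ?f z = ?f' z"
      using K AE_unit_pairI[OF v] unfolding unit_measure_pair
      by eventually_elim (simp add: case_prod_beta)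
    have f': "?f' \<in> borel_measurable borel"
      using borel_measurable_integrable[OF integrable_dirichlet[OF v']]
      unfolding unit_measure_pair by simp
    have O: "Omega \<times> Omega \<in> sets (borel :: (real \<times> real) measure)"
      by (simp add: borel_Times)
    show ?thesis
      using lebesgue_on_eq_uniform_on(2,3)[OF O f' ae] integrable_dirichlet[OF v']
      unfolding nonlocal_reg_def Let_def dirichlet_def unit_measure_pair by simp
  qed
  ultimately show ?thesis
    by (simp add: energy_def kernel_energy_def)
qed

section \<open>The kernels of the graphs against the closed support\<close>

lemma graph_kernel_ge:
  assumes n: "n \<ge> 1" and z: "z \<in> {0..<1} \<times> {0..<1}"
  shows "indicator (closure (kernel_supp K)) z \<le> graph_kernel n (graph_edges K n) z"
proof (cases "z \<in> closure (kernel_supp K)")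
  case True
  obtain i where i: "i \<in> {1..n}" "fst z \<in> cell n i"
    using cell_exists[OF n, of "fst z"] z by (auto simp: mem_Times_iff)
  obtain j where j: "j \<in> {1..n}" "snd z \<in> cell n j"
    using cell_exists[OF n, of "snd z"] z by (auto simp: mem_Times_iff)
  have "z \<in> cell n i \<times> cell n j"
    using i j by (simp add: mem_Times_iff)
  \<comment> \<open>The point \<open>z\<close> itself witnesses that the square meets the closed
    support.\<close>
  moreover from this have "(i, j) \<in> graph_edges K n"
    using i j True unfolding graph_edges_def by blast
  ultimately show ?thesis
    unfolding graph_kernel_def by auto
qed (simp add: graph_kernel_range)

lemma graph_edges_subset: "graph_edges K n \<subseteq> {1..n} \<times> {1..n}"
  by (auto simp: graph_edges_def)

lemma AE_unit_pair_lt_1: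
  "AE z in unit_measure \<Otimes>\<^sub>M unit_measure. z \<in> {0..<1} \<times> {0..<1}"
  using AE_unit_pairI[OF AE_unit_measure_lt_1] by eventually_elim (auto simp: mem_Times_iff)

text \<open>A squeeze of integrals: that of \<open>k\<close> lies between that of \<open>K\<close>
  and those of the graph kernels, which converge to that of \<open>K\<close>. Ordered functions with
  equal integrals agree a.e., so taking the closure adds only a null set.\<close>

lemma graph_limit_imp_L1:
  fixes K :: "real \<times> real \<Rightarrow> real"
  defines "k \<equiv> indicator (closure (kernel_supp K)) :: real \<times> real \<Rightarrow> real"
  assumes K01: "\<And>x y. x \<in> Omega \<Longrightarrow> y \<in> Omega \<Longrightarrow> K (x, y) \<in> {0, 1}"
    and Km: "K \<in> borel_measurable (lebesgue_on (Omega \<times> Omega))"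
    and lim: "is_graph_limit K (graph_edges K)"
  shows "AE z in unit_measure \<Otimes>\<^sub>M unit_measure. K z = k z"
    and "(\<lambda>n. \<integral>z. graph_kernel n (graph_edges K n) z - k z \<partial>(unit_measure \<Otimes>\<^sub>M unit_measure)) \<longlonglongrightarrow> 0"
proof -
  let ?M = "unit_measure \<Otimes>\<^sub>M unit_measure" and ?kn = "\<lambda>n. graph_kernel n (graph_edges K n)"
  have O: "Omega \<times> Omega \<in> sets (borel :: (real \<times> real) measure)"
    by (simp add: borel_Times)
  obtain K' where K': "K' \<in> borel_measurable borel" "AE z in uniform_on (Omega \<times> Omega). K z = K' z"
    using borel_representative[OF O Km] .
  have K'm [measurable]: "K' \<in> borel_measurable ?M"
    using K'(1) by (simp add: unit_measure_pair)
  have K'ae: "AE z in ?M. K z = K' z"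
    using K'(2) unfolding unit_measure_pair .
  have km [measurable]: "k \<in> borel_measurable ?M"
    unfolding k_def by (intro borel_measurable_indicator)
      (simp only: unit_measure_pair sets_uniform_on borel_closed closed_closure)
  have knm: "?kn n \<in> borel_measurable ?M" if "n \<ge> 1" for n
    by (rule graph_kernel_measurable[OF that graph_edges_subset])
  have kn_int: "integrable ?M (?kn n)" if "n \<ge> 1" for n
    using knm[OF that] graph_kernel_range by (intro unit_pair.integrable_const_bound[where B=1]) auto
  have k_int: "integrable ?M k"
    using km by (intro unit_pair.integrable_const_bound[where B=1]) (auto simp: k_def)
  have K'k: "AE z in ?M. 0 \<le> K' z \<and> K' z \<le> k z"
    using K'ae AE_unit_pair_lt_1
  proof eventually_elim
    case (elim z)
    then have z: "fst z \<in> Omega" "snd z \<in> Omega"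
      by (auto simp: mem_Times_iff)
    have "K z = 0 \<or> K z = 1"
      using K01[OF z] by simp
    moreover have "z \<in> closure (kernel_supp K)" if "K z \<noteq> 0"
      using that z by (intro subsetD[OF closure_subset]) (simp add: kernel_supp_def mem_Times_iff)
    ultimately show ?case
      using elim by (auto simp: k_def)
  qed
  have K'_int: "integrable ?M K'"
    by (rule Bochner_Integration.integrable_bound[OF k_int K'm])
       (use K'k in \<open>eventually_elim, auto\<close>)
  have "finite_simple_graph {0, 1} {(0, 1), (1, 0)}"
    by (auto simp: finite_simple_graph_def sym_def irrefl_def)
  with lim have "(\<lambda>n. hom_density {0, 1} {(0, 1), (1, 0)} (?kn n)) \<longlonglongrightarrow> hom_density {0, 1} {(0, 1), (1, 0)} K"
    unfolding is_graph_limit_def by blast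
  also have "hom_density {0, 1} {(0, 1), (1, 0)} K = (\<integral>z. K' z \<partial>?M)"
    by (rule hom_density_edge[OF K'm K'ae])
  finally have "(\<lambda>n. hom_density {0, 1} {(0, 1), (1, 0)} (?kn n)) \<longlonglongrightarrow> (\<integral>z. K' z \<partial>?M)" .
  moreover have "\<forall>\<^sub>F n in sequentially. hom_density {0, 1} {(0, 1), (1, 0)} (?kn n) = (\<integral>z. ?kn n z \<partial>?M)"
    using eventually_ge_at_top[of 1] by eventually_elim (intro hom_density_edge knm; simp)
  ultimately have conv: "(\<lambda>n. \<integral>z. ?kn n z \<partial>?M) \<longlonglongrightarrow> (\<integral>z. K' z \<partial>?M)"
    by (rule Lim_transform_eventually)
  have k_le: "(\<integral>z. k z \<partial>?M) \<le> (\<integral>z. ?kn n z \<partial>?M)" if n: "n \<ge> 1" for n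
    using AE_unit_pair_lt_1 graph_kernel_ge[OF n]
    by (intro integral_mono_AE k_int kn_int n) (auto simp: k_def elim!: eventually_mono)
  have "(\<integral>z. k z \<partial>?M) \<le> (\<integral>z. K' z \<partial>?M)"
    using k_le by (intro tendsto_lowerbound[OF conv] eventually_sequentiallyI[of 1]) auto
  moreover have "(\<integral>z. K' z \<partial>?M) \<le> (\<integral>z. k z \<partial>?M)"
    using K'k by (intro integral_mono_AE k_int K'_int) (auto elim!: eventually_mono)
  ultimately have eq: "(\<integral>z. k z \<partial>?M) = (\<integral>z. K' z \<partial>?M)"
    by simp
  then have "(\<integral>z. k z - K' z \<partial>?M) = 0"
    using k_int K'_int by simp
  then have "AE z in ?M. k z - K' z = 0"
    using K'k k_int K'_int by (subst (asm) integral_nonneg_eq_0_iff_AE) (auto elim!: eventually_mono)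
  with K'ae show "AE z in ?M. K z = k z"
    by eventually_elim simp
  have "(\<lambda>n. (\<integral>z. ?kn n z \<partial>?M) - (\<integral>z. k z \<partial>?M)) \<longlonglongrightarrow> (\<integral>z. K' z \<partial>?M) - (\<integral>z. k z \<partial>?M)"
    by (intro tendsto_diff conv tendsto_const)
  moreover have "\<forall>\<^sub>F n in sequentially. (\<integral>z. ?kn n z \<partial>?M) - (\<integral>z. k z \<partial>?M) = (\<integral>z. ?kn n z - k z \<partial>?M)"
    using eventually_ge_at_top[of 1] by eventually_elim (simp add: kn_int k_int)
  ultimately show "(\<lambda>n. \<integral>z. ?kn n z - k z \<partial>?M) \<longlonglongrightarrow> 0"
    unfolding eq by (simp add: Lim_transform_eventually)
qed

text \<open>The integrand is positive only at points outside the closed support whose square meets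
  that support. Such a square is convex, hence connected, and must meet the frontier. Each has area
  1 / n^2, and distinct squares lie in distinct mesh cells.\<close>

lemma boundary_measure_le:
  assumes n: "n \<ge> 1"
  shows "(\<integral>z. graph_kernel n (graph_edges K n) z - indicator (closure (kernel_supp K)) z
        \<partial>(unit_measure \<Otimes>\<^sub>M unit_measure))
    \<le> real (mesh_count (1 / real n) (frontier (closure (kernel_supp K)))) / (real n)\<^sup>2"
proof -
  let ?M = "unit_measure \<Otimes>\<^sub>M unit_measure" and ?kn = "graph_kernel n (graph_edges K n)"
  define T where "T = closure (kernel_supp K)"
  define E where "E = {(i, j) \<in> {1..n} \<times> {1..n}. (cell n i \<times> cell n j) \<inter> frontier T \<noteq> {}}"
  have E: "E \<subseteq> {1..n} \<times> {1..n}"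
    by (auto simp: E_def)
  have Tsub: "frontier T \<subseteq> Omega \<times> Omega"
  proof -
    have "closed (Omega \<times> Omega)"
      by (intro closed_Times) auto
    then have "T \<subseteq> Omega \<times> Omega"
      unfolding T_def by (intro closure_minimal) (auto simp: kernel_supp_def)
    moreover have "frontier T \<subseteq> T"
      by (simp add: T_def frontier_subset_closed)
    ultimately show ?thesis by blast
  qed
  have pt: "?kn z - indicator T z \<le> graph_kernel n E z" if z: "z \<in> {0..<1} \<times> {0..<1}" for z
  proof (cases "?kn z = 1 \<and> z \<notin> T")
    case True
    then obtain i j where ij: "(i, j) \<in> graph_edges K n" "z \<in> cell n i \<times> cell n j"
      unfolding graph_kernel_def by (auto split: if_splits)
    have "convex (cell n i \<times> cell n j)"
      unfolding cell_def by (intro convex_Times convex_real_interval)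
    then have "connected (cell n i \<times> cell n j)"
      by (rule convex_connected)
    then have "cell n i \<times> cell n j \<inter> frontier T \<noteq> {}"
      by (rule connected_Int_frontier) (use ij True in \<open>auto simp: graph_edges_def T_def\<close>)
    then have "(i, j) \<in> E"
      using ij(1) subsetD[OF graph_edges_subset ij(1)] by (auto simp: E_def)
    then have "graph_kernel n E z = 1"
      using ij(2) by (auto simp: graph_kernel_def)
    then show ?thesis
      using graph_kernel_range[of n "graph_edges K n" z] by (simp add: indicator_def)
  next
    case False
    then have "?kn z - indicator T z \<le> 0"
      by (auto simp: graph_kernel_def indicator_def split: if_splits)
    then show ?thesis
      using graph_kernel_range(1)[of n E z] by linarith
  qed
  have int: "integrable ?M (graph_kernel n F)" if "F \<subseteq> {1..n} \<times> {1..n}" for F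
    using graph_kernel_measurable[OF n that] graph_kernel_range
    by (intro unit_pair.integrable_const_bound[where B=1]) auto
  have Tint: "integrable ?M (indicator T :: _ \<Rightarrow> real)"
    by (intro unit_pair.integrable_const_bound[where B=1]) (auto simp: T_def unit_measure_pair)
  have "(\<integral>z. ?kn z - indicator T z \<partial>?M) \<le> (\<integral>z. graph_kernel n E z \<partial>?M)"
    using AE_unit_pair_lt_1 pt
    by (intro integral_mono_AE int E Bochner_Integration.integrable_diff graph_edges_subset Tint)
       (auto elim!: eventually_mono)
  also have "\<dots> = (\<Sum>(i, j)\<in>E. \<integral>z. indicator (cell n i \<times> cell n j) z \<partial>?M)"
    unfolding graph_kernel_sum[OF n E] case_prod_beta
    by (intro Bochner_Integration.integral_sum integrable_real_indicator cell_Times_in_sets)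
       (simp add: unit_pair.emeasure_eq_measure)
  also have "\<dots> = (\<Sum>e\<in>E. 1 / (real n)\<^sup>2)"
    using E measure_cell_Times[OF n] by (intro sum.cong) auto
  also have "\<dots> = real (card E) / (real n)\<^sup>2"
    by simp
  also have "\<dots> \<le> real (mesh_count (1 / real n) (frontier T)) / (real n)\<^sup>2"
  proof -
    let ?C = "{c. mesh_cell (1 / real n) c \<inter> frontier T \<noteq> {}}"
    \<comment> \<open>Finiteness is essential, as \<open>card\<close> is 0 on infinite sets. Closed
      mesh cells that merely touch \<open>Omega\<close> from outside account for the indices -1 and
      n.\<close>
    have "?C \<subseteq> {-1..int n} \<times> {-1..int n}"
    proof
      fix c assume "c \<in> ?C"
      then obtain x y where xy: "(x, y) \<in> mesh_cell (1 / real n) c" "x \<in> Omega" "y \<in> Omega"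
        using Tsub by blast
      have "-1 \<le> a \<and> a \<le> int n" if "x \<in> {of_int a * (1 / real n) .. (of_int a + 1) * (1 / real n)}" "x \<in> Omega"
        for a :: int and x
      proof -
        have "of_int a \<le> real n * x" "real n * x \<le> of_int a + 1" "0 \<le> real n * x" "real n * x \<le> real n"
          using that n by (auto simp: field_simps mult_left_le)
        then show ?thesis
          by linarith
      qed
      then show "c \<in> {-1..int n} \<times> {-1..int n}"
        using xy by (auto simp: mesh_cell_def split: prod.splits)
    qed
    then have finC: "finite ?C"
      by (rule finite_subset) auto
    \<comment> \<open>Cells are numbered from 1 and mesh cells from 0; a half-open cell lies in the
      closed mesh cell with index shifted by one.\<close>
    have "(\<lambda>(i, j). (int i - 1, int j - 1)) ` E \<subseteq> ?C"
    proof (rule image_subsetI)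
      fix e assume e: "e \<in> E"
      obtain i j where ij: "e = (i, j)"
        by fastforce
      have "cell n i \<times> cell n j \<subseteq> mesh_cell (1 / real n) (int i - 1, int j - 1)"
        by (auto simp: cell_def mesh_cell_def)
      then show "(case e of (i, j) \<Rightarrow> (int i - 1, int j - 1)) \<in> ?C"
        using e unfolding ij E_def by auto
    qed
    then have "card ((\<lambda>(i, j). (int i - 1, int j - 1)) ` E) \<le> card ?C"
      by (rule card_mono[OF finC])
    moreover have "inj_on (\<lambda>(i, j). (int i - 1, int j - 1)) E"
      by (auto simp: inj_on_def)
    ultimately show ?thesis
      by (intro divide_right_mono) (simp_all add: mesh_count_def card_image)
  qed
  finally show ?thesis
    by (simp add: T_def)
qed

text \<open>The upper limit is read along the meshes 1 / n, where - ln (1 / n) = ln n turns a bound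
  on the quotient of logarithms into a power of n. From n = 2 on the denominator is positive, and a
  zero count is set apart because \<open>ln 0 = 0\<close>.\<close>

lemma eventually_mesh_count_le:
  assumes dim: "upper_box_dim S = ereal \<rho>" and e: "e > 0"
  shows "\<forall>\<^sub>F n in sequentially. real (mesh_count (1 / real n) S) \<le> real n powr (\<rho> + e)"
proof -
  have "Limsup (at_right 0) (\<lambda>\<delta>. ereal (ln (real (mesh_count \<delta> S)) / (- ln \<delta>))) < ereal (\<rho> + e)"
    using dim e by (simp add: upper_box_dim_def)
  then have "\<forall>\<^sub>F \<delta> in at_right 0. ereal (ln (real (mesh_count \<delta> S)) / (- ln \<delta>)) < ereal (\<rho> + e)"
    by (rule Limsup_lessD)
  moreover have "filterlim (\<lambda>n. 1 / real n) (at_right 0) sequentially"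
    unfolding filterlim_at
    using lim_1_over_n eventually_gt_at_top[of 0] by (auto elim!: eventually_mono)
  ultimately have "\<forall>\<^sub>F n in sequentially.
      ereal (ln (real (mesh_count (1 / real n) S)) / (- ln (1 / real n))) < ereal (\<rho> + e)"
    by (rule eventually_compose_filterlim)
  then show ?thesis
    using eventually_ge_at_top[of 2]
  proof eventually_elim
    case (elim n)
    have ln: "ln (real n) > 0" "- ln (1 / real n) = ln (real n)"
      using elim by (auto simp: ln_div)
    show ?case
    proof (cases "mesh_count (1 / real n) S = 0")
      case False
      have "ln (real (mesh_count (1 / real n) S)) \<le> (\<rho> + e) * ln (real n)"
        using elim ln by (simp add: pos_divide_less_eq)
      then have "exp (ln (real (mesh_count (1 / real n) S))) \<le> exp ((\<rho> + e) * ln (real n))"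
        by simp
      then show ?thesis
        using False elim by (simp add: powr_def)
    qed simp
  qed
qed

section \<open>Assembly: Borel data, convergence, rate\<close>

theorem theorem5p1:
  fixes lam p :: real
    and g ustar :: "real \<Rightarrow> real"
    and K :: "real \<times> real \<Rightarrow> real"
    and u :: "nat \<Rightarrow> nat \<Rightarrow> real"
  assumes "lam > 0"
    and "p \<in> {1..2}"
    and "g \<in> L_space 2"
    and "\<And>x y. x \<in> Omega \<Longrightarrow> y \<in> Omega \<Longrightarrow> K (x, y) \<in> {0, 1}"
    and "K \<in> borel_measurable (lebesgue_on (Omega \<times> Omega))"
    and "\<And>x y. x \<in> Omega \<Longrightarrow> y \<in> Omega \<Longrightarrow> K (x, y) = K (y, x)"
    and "is_graph_limit K (graph_edges K)"
    and "is_arg_min (energy lam p g K) (\<lambda>v. v \<in> L_space 2) ustar"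
    and "\<And>n. n \<ge> 1 \<Longrightarrow> is_arg_min (discrete_energy lam p g K n) (\<lambda>_. True) (u n)"
  shows "((\<lambda>n. L_norm 2 (\<lambda>x. step_fun n (u n) x - ustar x)) \<longlonglongrightarrow> 0) \<and>
    (\<forall>s q \<rho> :: real. \<forall>J :: real \<Rightarrow> real.
       p < 2 \<longrightarrow> s \<in> {0<..1} \<longrightarrow> q \<in> {2 / (3 - p)..2} \<longrightarrow>
       g \<in> L_infinity \<inter> Lip_space s q \<longrightarrow>
       upper_box_dim (frontier (closure (kernel_supp K))) = ereal \<rho> \<longrightarrow> \<rho> \<in> {0..<2} \<longrightarrow>
       J \<in> borel_measurable (lebesgue_on Omega) \<longrightarrow>
       (\<forall>r\<in>Omega. 0 \<le> J r) \<longrightarrow> (\<exists>B. \<forall>r\<in>Omega. J r \<le> B) \<longrightarrow>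
       (\<forall>x\<in>Omega. \<forall>y\<in>Omega. K (x, y) = J \<bar>x - y\<bar>) \<longrightarrow>
       (\<exists>C>0. \<forall>\<epsilon>>0. \<exists>N. \<forall>n\<ge>N.
          (L_norm 2 (\<lambda>x. step_fun n (u n) x - ustar x))\<^sup>2
            \<le> C * real n powr (- min (s * q / 2) ((2 - p) * (1 - (\<rho> + \<epsilon>) / 2)))))"
proof -
  let ?U = unit_measure and ?M = "unit_measure \<Otimes>\<^sub>M unit_measure"
  let ?kn = "\<lambda>n. graph_kernel n (graph_edges K n)" and ?err = "\<lambda>n. L_norm 2 (\<lambda>x. step_fun n (u n) x - ustar x)"
  define k where "k = (indicator (closure (kernel_supp K)) :: real \<times> real \<Rightarrow> real)"
  have p: "1 \<le> p" "p \<le> 2"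
    using assms(2) by auto
  have K_k: "AE z in ?M. K z = k z"
    and conv: "(\<lambda>n. \<integral>z. ?kn n z - k z \<partial>?M) \<longlonglongrightarrow> 0"
    unfolding k_def using graph_limit_imp_L1[OF assms(4,5,7)] by simp_all
  have km [measurable]: "k \<in> borel_measurable ?M"
    unfolding k_def by (intro borel_measurable_indicator)
      (simp only: unit_measure_pair sets_uniform_on borel_closed closed_closure)
  have k_le: "AE z in ?M. 0 \<le> ?kn n z - k z \<and> ?kn n z - k z \<le> 1" if n: "n \<ge> 1" for n
    using AE_unit_pair_lt_1
  proof eventually_elim
    case (elim z)
    then show ?case
      using graph_kernel_ge[OF n elim, of K] graph_kernel_range[of n "graph_edges K n" z]
      by (simp add: k_def indicator_def)
  qed
  have ustar: "ustar \<in> L_space 2"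
    and ustar_min: "\<And>v. v \<in> L_space 2 \<Longrightarrow> \<not> energy lam p g K v < energy lam p g K ustar"
    using assms(8) by (auto simp: is_arg_min_def)
  have "ustar \<in> borel_measurable (lebesgue_on Omega)"
    using ustar by (simp add: L_space_def)
  then obtain us where us_b: "us \<in> borel_measurable borel" and us_ae: "AE x in ?U. ustar x = us x"
    by (rule borel_representative[rotated]) auto
  have us: "us \<in> sq_integrable ?U"
    by (rule L_space_2_representative[OF ustar us_b us_ae])
  have "g \<in> borel_measurable (lebesgue_on Omega)"
    using assms(3) by (simp add: L_space_def)
  then obtain g' where g'_b: "g' \<in> borel_measurable borel" and g'_ae: "AE x in ?U. g x = g' x"
    by (rule borel_representative[rotated]) auto

  \<comment> \<open>Stated for every Borel representative of \<open>g\<close>, because two occur: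
    \<open>g'\<close> for the convergence, and a clipped one, bounded at every point, for the
    rate.\<close>
  have problem: "kernel_problem ?U lam p f k"
    and min: "v \<in> sq_integrable ?U \<Longrightarrow> kernel_energy ?U lam p f k us \<le> kernel_energy ?U lam p f k v"
    if f: "f \<in> borel_measurable borel" "AE x in ?U. g x = f x" for f v
  proof -
    show kp: "kernel_problem ?U lam p f k"
      using assms(1) p L_space_2_representative[OF assms(3) f] km by unfold_locales (auto simp: k_def)
    assume v: "v \<in> sq_integrable ?U"
    show "kernel_energy ?U lam p f k us \<le> kernel_energy ?U lam p f k v"
      using ustar_min[OF sq_integrable_in_L_space[OF v]]
        energy_eq[OF kp f(2) K_k us us_ae] energy_eq[OF kp f(2) K_k v, of v] by simp
  qed
  have err_sq: "(?err n)\<^sup>2 = (\<integral>x. (step_fun n (u n) x - us x)\<^sup>2 \<partial>?U)" for n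
    using us_b us_ae by (intro L_norm_2_eq) (auto elim!: eventually_mono)
  have est: "(?err n)\<^sup>2 \<le> (\<integral>x. (step_fun n (cell_avg f n) x - f x)\<^sup>2 \<partial>?U)
      + lam / p * (\<integral>z. (?kn n z - k z) * \<bar>us (snd z) - us (fst z)\<bar> powr p \<partial>?M)"
    if n: "n \<ge> 1" and f: "f \<in> borel_measurable borel" "AE x in ?U. g x = f x" for n f
  proof -
    have avg: "cell_avg f n i = cell_avg g n i" if "i \<in> {1..n}" for i
      using cell_avg_eq[OF n that f] cell_avg_eq[OF n that f(1), of f] by simp
    have D: "discrete_energy lam p g K n v = 1 / (2 * lam * real n) * (\<Sum>i=1..n. (v i - cell_avg f n i)\<^sup>2)
        + 1 / (2 * p * (real n)\<^sup>2) * (\<Sum>(i, j)\<in>graph_edges K n. \<bar>v j - v i\<bar> powr p)" for v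
    proof -
      have "(\<Sum>i=1..n. \<bar>v i - cell_avg g n i\<bar>\<^sup>2) = (\<Sum>i=1..n. (v i - cell_avg f n i)\<^sup>2)"
        using avg by (intro sum.cong) auto
      then show ?thesis
        unfolding discrete_energy_def by simp
    qed
    have le: "discrete_energy lam p g K n (u n) \<le> discrete_energy lam p g K n v" for v
      using assms(9)[OF n] by (auto simp: is_arg_min_def not_less)
    have ge: "AE z in ?M. k z \<le> ?kn n z"
      using k_le[OF n] by eventually_elim simp
    show ?thesis
      unfolding err_sq
      by (rule discretization_error[OF n graph_edges_subset problem[OF f] us min[OF f] ge le[unfolded D]])
  qed

  interpret kernel_problem ?U lam p g' k
    by (rule problem[OF g'_b g'_ae])
  have kn_int: "integrable ?M (\<lambda>z. ?kn n z - k z)" if n: "n \<ge> 1" for n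
  proof (rule unit_pair.integrable_const_bound[where B=1])
    show "AE z in ?M. norm (?kn n z - k z) \<le> 1"
      using k_le[OF n] by eventually_elim simp
    show "(\<lambda>z. ?kn n z - k z) \<in> borel_measurable ?M"
      using graph_kernel_measurable[OF n graph_edges_subset, of K] by simp
  qed
  have err_tendsto: "(\<lambda>n. (?err n)\<^sup>2) \<longlonglongrightarrow> 0"
  proof (rule tendsto_sandwich[OF _ _ tendsto_const])
    \<comment> \<open>Here \<open>us\<close> may be unbounded, so the defect is tested against a
      merely integrable function.\<close>
    have "(\<lambda>n. \<integral>z. (?kn n z - k z) * \<bar>us (snd z) - us (fst z)\<bar> powr p \<partial>?M) \<longlonglongrightarrow> 0"
      by (rule integral_mult_tendsto_0[OF integrable_powr_diff[OF us] _ kn_int k_le conv]) auto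
    from tendsto_add[OF cell_avg_step_fun_converges[OF g] tendsto_mult_left[OF this, of "lam / p"]]
    show "(\<lambda>n. (\<integral>x. (step_fun n (cell_avg g' n) x - g' x)\<^sup>2 \<partial>?U)
        + lam / p * (\<integral>z. (?kn n z - k z) * \<bar>us (snd z) - us (fst z)\<bar> powr p \<partial>?M)) \<longlonglongrightarrow> 0"
      by simp
    show "\<forall>\<^sub>F n in sequentially. (?err n)\<^sup>2 \<le> (\<integral>x. (step_fun n (cell_avg g' n) x - g' x)\<^sup>2 \<partial>?U)
        + lam / p * (\<integral>z. (?kn n z - k z) * \<bar>us (snd z) - us (fst z)\<bar> powr p \<partial>?M)"
      using eventually_ge_at_top[of 1] by eventually_elim (intro est g'_b g'_ae; simp)
  qed auto
  have err_nonneg: "?err n \<ge> 0" for n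
    by (simp add: L_norm_def)
  show ?thesis
  proof (intro conjI allI impI)
    show "?err \<longlonglongrightarrow> 0"
      using tendsto_real_sqrt[OF err_tendsto] err_nonneg by simp
  next
    fix s q \<rho> :: real and J :: "real \<Rightarrow> real"
    assume "p < 2" and s: "s \<in> {0<..1}" and q: "q \<in> {2 / (3 - p)..2}"
      and gL: "g \<in> L_infinity \<inter> Lip_space s q"
      and dim: "upper_box_dim (frontier (closure (kernel_supp K))) = ereal \<rho>"
    have q12: "1 \<le> q" "q \<le> 2"
    proof -
      \<comment> \<open>The lower bound on q makes \<open>powr q\<close> convex, as Jensen on the
        cells demands.\<close>
      have "1 \<le> 2 / (3 - p)"
        using p by (simp add: field_simps)
      then show "1 \<le> q" "q \<le> 2"
        using q by auto
    qed
    from gL obtain B0 where "AE x in lebesgue_on Omega. \<bar>g x\<bar> \<le> B0"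
      by (auto simp: L_infinity_def)
    then have "AE x in lborel. x \<in> Omega \<longrightarrow> \<bar>g x\<bar> \<le> B0"
      by (simp add: AE_restrict_space_iff AE_completion_iff)
    then have gB0: "AE x in ?U. \<bar>g x\<bar> \<le> B0"
      by (simp add: AE_uniform_on)
    define B where "B = max 0 B0"
    have B: "B \<ge> 0" by (simp add: B_def)
    define f where "f x = max (- B) (min (g' x) B)" for x
    have f_b [measurable]: "f \<in> borel_measurable borel"
      unfolding f_def using g'_b by measurable
    have f_ae: "AE x in ?U. g x = f x"
      using gB0 g'_ae by eventually_elim (auto simp: f_def B_def)
    have fB: "\<bar>f x\<bar> \<le> B" for x
      using B by (auto simp: f_def)
    have usB: "AE x in ?U. \<bar>us x\<bar> \<le> B"
      using fB by (intro kernel_problem.minimizer_bounded[OF problem[OF f_b f_ae] us min[OF f_b f_ae]]) auto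
    obtain L where L: "L \<ge> 0" "\<And>h z. h > 0 \<Longrightarrow> \<bar>z\<bar> < h \<Longrightarrow>
        (\<integral>\<^sup>+x. indicator {x. x \<in> Omega \<and> x + z \<in> Omega} x * ennreal (\<bar>f (x + z) - f x\<bar> powr q) \<partial>lborel)
        \<le> ennreal (L * h powr (s * q))"
      using Lip_space_shift_bound[OF _ q12(1) f_b fB f_ae, of s] gL by auto
    define C1 where "C1 = (2 * B) powr (2 - q) * (2 * L)"
    define C2 where "C2 = lam / p * (2 * B) powr p"
    have C: "C1 \<ge> 0" "C2 \<ge> 0"
      using L(1) assms(1) p by (simp_all add: C1_def C2_def)
    \<comment> \<open>The shift bound is taken at h = 1 / n.\<close>
    have rate1: "(\<integral>x. (step_fun n (cell_avg f n) x - f x)\<^sup>2 \<partial>?U) \<le> C1 * real n powr (- (s * q))"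
      if n: "n \<ge> 1" for n
    proof -
      have "(\<integral>x. (step_fun n (cell_avg f n) x - f x)\<^sup>2 \<partial>?U)
          \<le> (2 * B) powr (2 - q) * (2 * (L * (1 / real n) powr (s * q)))"
        using n L by (intro cell_avg_square_error_le q12 f_b fB) auto
      also have "(1 / real n) powr (s * q) = real n powr (- (s * q))"
        using n by (simp add: powr_divide powr_minus_divide)
      finally show ?thesis
        by (simp add: C1_def mult.assoc)
    qed
    have rate2: "lam / p * (\<integral>z. (?kn n z - k z) * \<bar>us (snd z) - us (fst z)\<bar> powr p \<partial>?M)
        \<le> C2 * (real (mesh_count (1 / real n) (frontier (closure (kernel_supp K)))) / (real n)\<^sup>2)"
      if n: "n \<ge> 1" for n
    proof -
      have "(\<integral>z. (?kn n z - k z) * \<bar>us (snd z) - us (fst z)\<bar> powr p \<partial>?M)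
          \<le> (\<integral>z. (2 * B) powr p * (?kn n z - k z) \<partial>?M)"
      proof (rule integral_mono_AE)
        show "integrable ?M (\<lambda>z. (2 * B) powr p * (?kn n z - k z))"
          using kn_int[OF n] by simp
        show "integrable ?M (\<lambda>z. (?kn n z - k z) * \<bar>us (snd z) - us (fst z)\<bar> powr p)"
        proof (rule Bochner_Integration.integrable_bound[OF integrable_powr_diff[OF us]])
          show "(\<lambda>z. (?kn n z - k z) * \<bar>us (snd z) - us (fst z)\<bar> powr p) \<in> borel_measurable ?M"
            using borel_measurable_integrable[OF kn_int[OF n]] borel_measurable_integrable[OF integrable_powr_diff[OF us]]
            by (rule borel_measurable_times)
          show "AE z in ?M. norm ((?kn n z - k z) * \<bar>us (snd z) - us (fst z)\<bar> powr p)
              \<le> norm (\<bar>us (snd z) - us (fst z)\<bar> powr p)"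
            using k_le[OF n] by eventually_elim (simp add: abs_mult mult_left_le_one_le)
        qed
        show "AE z in ?M. (?kn n z - k z) * \<bar>us (snd z) - us (fst z)\<bar> powr p \<le> (2 * B) powr p * (?kn n z - k z)"
          using k_le[OF n] AE_unit_pairI[OF usB]
        proof eventually_elim
          case (elim z)
          have "\<bar>us (snd z) - us (fst z)\<bar> powr p \<le> (2 * B) powr p"
            using elim p by (intro powr_mono2) auto
          then show ?case
            unfolding mult.commute[of "(2 * B) powr p"] using elim by (intro mult_left_mono) auto
        qed
      qed
      also have "\<dots> = (2 * B) powr p * (\<integral>z. ?kn n z - k z \<partial>?M)"
        by simp
      also have "\<dots> \<le> (2 * B) powr p
          * (real (mesh_count (1 / real n) (frontier (closure (kernel_supp K)))) / (real n)\<^sup>2)"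
        unfolding k_def by (intro mult_left_mono boundary_measure_le n) auto
      finally have "lam / p * (\<integral>z. (?kn n z - k z) * \<bar>us (snd z) - us (fst z)\<bar> powr p \<partial>?M)
          \<le> lam / p * ((2 * B) powr p
          * (real (mesh_count (1 / real n) (frontier (closure (kernel_supp K)))) / (real n)\<^sup>2))"
        using assms(1) p by (intro mult_left_mono) auto
      then show ?thesis
        by (simp add: C2_def mult.assoc)
    qed
    show "\<exists>C>0. \<forall>\<epsilon>>0. \<exists>N. \<forall>n\<ge>N.
        (?err n)\<^sup>2 \<le> C * real n powr (- min (s * q / 2) ((2 - p) * (1 - (\<rho> + \<epsilon>) / 2)))"
    \<comment> \<open>Neither \<open>C1\<close> nor \<open>C2\<close> depends on \<epsilon>. The
      summand 1 makes the constant positive and serves the case of large \<epsilon>.\<close>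
    proof (intro exI[of _ "C1 + C2 + 1"] conjI allI impI)
      show "C1 + C2 + 1 > 0"
        using C by linarith
      fix \<epsilon> :: real assume \<epsilon>: "\<epsilon> > 0"
      define a where "a = 1 - (\<rho> + \<epsilon>) / 2"
      define m where "m = min (s * q / 2) ((2 - p) * a)"
      have "\<forall>\<^sub>F n in sequentially. (?err n)\<^sup>2 \<le> (C1 + C2 + 1) * real n powr (- m)"
      \<comment> \<open>The kernel rate is \<open>2 * a\<close>. It beats (2 - p) * a only for
        nonnegative \<open>a\<close>, that is, for \<rho> + \<epsilon> \<le> 2.\<close>
      proof (cases "a \<ge> 0")
        case True
        have sq: "s * q \<ge> 0"
          using s q12 by auto
        have "m \<le> s * q"
          unfolding m_def using sq by linarith
        have "(2 - p) * a \<le> 2 * a"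
          using True p by (intro mult_right_mono) auto
        then have "m \<le> 2 * a"
          unfolding m_def by linarith
        show ?thesis
          using eventually_mesh_count_le[OF dim \<epsilon>] eventually_ge_at_top[of 1]
        proof eventually_elim
          case (elim n)
          have n: "real n \<ge> 1"
            using elim by simp
          have "(?err n)\<^sup>2 \<le> C1 * real n powr (- (s * q))
              + C2 * (real (mesh_count (1 / real n) (frontier (closure (kernel_supp K)))) / (real n)\<^sup>2)"
            using est[OF elim(2) f_b f_ae] rate1[OF elim(2)] rate2[OF elim(2)] by linarith
          also have "\<dots> \<le> C1 * real n powr (- (s * q)) + C2 * (real n powr (\<rho> + \<epsilon>) / (real n)\<^sup>2)"
            using elim C by (intro add_left_mono mult_left_mono divide_right_mono) auto
          also have "real n powr (\<rho> + \<epsilon>) / (real n)\<^sup>2 = real n powr (- (2 * a))"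
          proof -
            have "(real n)\<^sup>2 = real n powr 2"
              using n by (simp add: powr_numeral)
            moreover have "\<rho> + \<epsilon> - 2 = - (2 * a)"
              by (simp add: a_def)
            ultimately show ?thesis
              using powr_diff[of "real n" "\<rho> + \<epsilon>" 2] by simp
          qed
          also have "C1 * real n powr (- (s * q)) + C2 * real n powr (- (2 * a))
              \<le> C1 * real n powr (- m) + C2 * real n powr (- m)"
            using n C \<open>m \<le> s * q\<close> \<open>m \<le> 2 * a\<close>
            by (intro add_mono mult_left_mono powr_mono) auto
          also have "\<dots> \<le> (C1 + C2 + 1) * real n powr (- m)"
            by (simp add: distrib_right)
          finally show ?case .
        qed
      next
        case False
        \<comment> \<open>For negative \<open>a\<close> the exponent - m is nonnegative, so the
          claimed bound stays above 1 and follows from the squared error tending to 0.\<close>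
        have "m \<le> (2 - p) * a"
          by (simp add: m_def)
        also have "\<dots> \<le> 0"
          using False p by (intro mult_nonneg_nonpos) auto
        finally have m: "m \<le> 0" .
        have "\<forall>\<^sub>F n in sequentially. (?err n)\<^sup>2 < 1"
          by (rule order_tendstoD(2)[OF err_tendsto]) simp
        then show ?thesis
          using eventually_ge_at_top[of 1]
        proof eventually_elim
          case (elim n)
          have "1 \<le> real n powr (- m)"
            using elim m by (intro ge_one_powr_ge_zero) auto
          then have "1 * 1 \<le> (C1 + C2 + 1) * real n powr (- m)"
            using C by (intro mult_mono) auto
          then show ?case
            using elim by linarith
        qed
      qed
      then show "\<exists>N. \<forall>n\<ge>N. (?err n)\<^sup>2
          \<le> (C1 + C2 + 1) * real n powr (- min (s * q / 2) ((2 - p) * (1 - (\<rho> + \<epsilon>) / 2)))"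
        unfolding eventually_sequentially m_def a_def .
    qed
  qed
qed

end
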